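(* Let $n\in\mathbb{Z}_{\ge2}$ and $k\in\frac12\mathbb{Z}_{\ge0}$. Then the partition algebra $\mathbb{C}A_k(n)$ is semisimple if and only if $k\le\frac{n+1}{2}$.
   Context: For an integer $m\ge0$, $A_m$ is the set of set partitions of $\{1,\ldots,m,1',\ldots,m'\}$ ($A_0$ has one element), and $A_{m+\frac12}$ is the set of $d\in A_{m+1}$ in which $m+1$ and $(m+1)'$ are in the same block. The composition $d_1\circ d_2$ is obtained by placing $d_1$ above $d_2$ (top row unprimed, bottom row primed), identifying bottom vertex $i'$ of $d_1$ with top vertex $i$ of $d_2$, and removing the connected components lying entirely in the middle row. The partition algebra $\mathbb{C}A_k(n)$ is the complex algebra with basis $A_k$ and product $d_1d_2=n^{\ell}(d_1\circ d_2)$, where $\ell$ is the number of components removed. *)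

theory Defs
  imports Complex_Main "HOL-Library.Disjoint_Sets" "HOL-Algebra.Algebraic_Closure_Type"
begin

section \<open>Partition diagrams\<close>

text \<open>\<open>Inl i\<close> is the top vertex $i$ and \<open>Inr i\<close> the bottom vertex $i'$.\<close>

type_synonym diagram = "(nat + nat) set set"

text \<open>For a half-integer $k = m + 1/2$ the diagrams live on $m + 1 = \lceil k \rceil$ columns.\<close>

definition columns :: "rat \<Rightarrow> nat" where
  "columns k = nat \<lceil>k\<rceil>"

definition vertices :: "nat \<Rightarrow> (nat + nat) set" where
  "vertices m = Inl ` {1..m} \<union> Inr ` {1..m}"

definition diagrams :: "rat \<Rightarrow> diagram set" where
  "diagrams k =
     (if k \<in> \<nat> then {d. partition_on (vertices (columns k)) d}
      else {d. partition_on (vertices (columns k)) d \<and>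
               (\<exists>B\<in>d. Inl (columns k) \<in> B \<and> Inr (columns k) \<in> B)})"

text \<open>Stacking \<open>d1\<close> above \<open>d2\<close>: the vertices \<open>Inr i\<close> of \<open>d1\<close> and \<open>Inl i\<close> of \<open>d2\<close> both become
  \<open>Mid i\<close>.\<close>

datatype stacked_vertex = Top nat | Mid nat | Bot nat

definition stacked_blocks :: "diagram \<Rightarrow> diagram \<Rightarrow> stacked_vertex set set" where
  "stacked_blocks d1 d2 = image (case_sum Top Mid) ` d1 \<union> image (case_sum Mid Bot) ` d2"

definition components :: "diagram \<Rightarrow> diagram \<Rightarrow> stacked_vertex set set" where
  "components d1 d2 =
     \<Union>(stacked_blocks d1 d2) // {(u, v). \<exists>B\<in>stacked_blocks d1 d2. u \<in> B \<and> v \<in> B}\<^sup>*"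

definition removed :: "diagram \<Rightarrow> diagram \<Rightarrow> nat" where
  "removed d1 d2 = card {C \<in> components d1 d2. C \<subseteq> range Mid}"

definition compose_diagrams :: "diagram \<Rightarrow> diagram \<Rightarrow> diagram" where
  "compose_diagrams d1 d2 = {case_sum Top Bot -` C | C. C \<in> components d1 d2 \<and> \<not> C \<subseteq> range Mid}"

definition id_diagram :: "nat \<Rightarrow> diagram" where
  "id_diagram m = (\<lambda>i. {Inl i, Inr i}) ` {1..m}"


section \<open>The partition algebra\<close>

text \<open>An element is its coefficient function, which vanishes off the basis \<open>diagrams k\<close>. The product
  extends $d_1 d_2 = x^\ell (d_1 \circ d_2)$ bilinearly. The record type \<open>module\<close> carries the ring
  structure together with the scalar multiplication.\<close>

definition partition_algebra :: "rat \<Rightarrow> complex \<Rightarrow> (complex, diagram \<Rightarrow> complex) module" where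
  "partition_algebra k x =
    \<lparr> carrier = {f. \<forall>d. d \<notin> diagrams k \<longrightarrow> f d = 0},
      monoid.mult = (\<lambda>f g d. \<Sum>d1\<in>diagrams k. \<Sum>d2\<in>diagrams k.
                if compose_diagrams d1 d2 = d then f d1 * g d2 * x ^ removed d1 d2 else 0),
      monoid.one = (\<lambda>d. if d = id_diagram (columns k) then 1 else 0),
      ring.zero = (\<lambda>d. 0),
      ring.add = (\<lambda>f g d. f d + g d),
      module.smult = (\<lambda>c f d. c * f d) \<rparr>"


section \<open>Semisimple algebras\<close>

text \<open>An algebra is semisimple if its left regular module is a direct sum of simple modules. As an
  algebra with unit is finitely generated over itself, only finite sums have to be considered.\<close>

definition left_ideal :: "'b set \<Rightarrow> (complex, 'b) module \<Rightarrow> bool" where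
  "left_ideal I A \<longleftrightarrow> submodule I ring_of_type_algebra A \<and>
     (\<forall>a\<in>carrier A. \<forall>x\<in>I. a \<otimes>\<^bsub>A\<^esub> x \<in> I)"

definition simple_left_ideal :: "'b set \<Rightarrow> (complex, 'b) module \<Rightarrow> bool" where
  "simple_left_ideal I A \<longleftrightarrow> left_ideal I A \<and> I \<noteq> {\<zero>\<^bsub>A\<^esub>} \<and>
     (\<forall>J. left_ideal J A \<and> J \<subseteq> I \<longrightarrow> J = {\<zero>\<^bsub>A\<^esub>} \<or> J = I)"

definition semisimple_algebra :: "(complex, 'b) module \<Rightarrow> bool" where
  "semisimple_algebra A \<longleftrightarrow>
     (\<exists>S. finite S \<and> (\<forall>L\<in>S. simple_left_ideal L A) \<and>
          (\<forall>a\<in>carrier A. \<exists>!f. f \<in> (\<Pi>\<^sub>E L\<in>S. L) \<and> a = (\<Oplus>\<^bsub>A\<^esub>L\<in>S. f L)))"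

end

theory Submission
  imports Defs "HOL-Library.Function_Algebras"
begin

text \<open>The algebra acts on the $k$-th tensor power of $\mathbb{C}^n$: a diagram becomes the 0-1 matrix
  that records which colorings of its top and bottom row with \<open>n\<close> colors are constant on blocks.
  Evaluating a combination of diagrams in the kernel at a coloring that separates the blocks of \<open>d\<close>
  shows that its coefficients sum to 0 over all refinements of \<open>d\<close>, provided \<open>d\<close> has at most \<open>n\<close>
  blocks.

  If $2k \<le> n + 1$, only the finest diagram can have more than \<open>n\<close> blocks, and such a combination is
  determined by its coefficient at the finest diagram. It is detected by the character that sends
  permutation diagrams to 1 and all other diagrams to 0, since all permutation diagrams have the same
  coefficient up to a common sign. So the tensor representation plus this character is faithful. As it
  turns flipping of diagrams into the conjugate transpose, it gives a positive definite
  form for which left ideals have orthogonal complements.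

  If $2k \<ge> n + 2$, cut off the last columns with an idempotent multiple of a diagram \<open>p\<close>, leaving
  about $n/2$ of them: then $pAp$ acts faithfully but $Ap$ does not. A nonzero $y \<in> Ap$ that acts as 0
  satisfies $pAy = 0$, hence $yAy = 0$, which is impossible in a semisimple algebra.\<close>

section \<open>Semisimplicity from an invariant inner product\<close>

text \<open>The threshold comes from counting blocks. A diagram has at most 2k of them, since gluing
  the last column in the half-integral case costs one, and only the finest diagram attains 2k. For
  2k <= n the matrices alone are faithful; at 2k = n + 1 no coloring separates the blocks of the
  finest diagram, and the extra character is there to detect what the matrices may miss. Beyond
  that, cutting a set J of columns lowers the number of blocks that need distinct colors: off the
  isolated vertices, Ap still has diagrams with 2k - |J| > n blocks, while those of pAp have at most
  2k - 2|J| <= n. Connected components are awkward to follow through stacked diagrams. They are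
  examined only to show that a composition is a partition and to count the colorings of the middle
  row. Associativity, unit, reflection and the structure of products are then read off from
  colorings with 2 colors: two colors already determine a partition, and the base 2 determines the
  number of removed components.\<close>

definition scale_fun :: "complex \<Rightarrow> ('b \<Rightarrow> complex) \<Rightarrow> 'b \<Rightarrow> complex" where
  "scale_fun c f = (\<lambda>d. c * f d)"

lemma scale_fun_apply [simp]: "scale_fun c f d = c * f d"
  by (simp add: scale_fun_def)

text \<open>One ambient complex vector space of coefficient functions, in which the library notions
  of span, independence and dimension apply to left ideals.\<close>

interpretation fun_space: vector_space "scale_fun :: complex \<Rightarrow> ('b \<Rightarrow> complex) \<Rightarrow> 'b \<Rightarrow> complex"
  by standard (simp_all add: fun_eq_iff algebra_simps)

lemma sum_fun_apply: "(\<Sum>x\<in>S. f x) d = (\<Sum>x\<in>S. f x d :: complex)"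
  by (induction S rule: infinite_finite_induct) auto

text \<open>Separates the semisimplicity arguments from the combinatorics of diagrams: addition and
  scaling are pointwise, so the algebra is a subspace of \<open>fun_space\<close>.\<close>

locale function_algebra =
  fixes A :: "(complex, 'b \<Rightarrow> complex) module" (structure) and D :: "'b set"
  assumes finite_basis: "finite D"
    and carrier_eq: "carrier A = {f. \<forall>d. d \<notin> D \<longrightarrow> f d = 0}"
    and zero_eq: "\<zero> = 0"
    and add_eq: "f \<oplus> g = f + g"
    and smult_eq: "c \<odot> f = scale_fun c f"
    and mult_closed: "\<lbrakk>f \<in> carrier A; g \<in> carrier A\<rbrakk> \<Longrightarrow> f \<otimes> g \<in> carrier A"
    and mult_assoc: "\<lbrakk>f \<in> carrier A; g \<in> carrier A; h \<in> carrier A\<rbrakk> \<Longrightarrow> (f \<otimes> g) \<otimes> h = f \<otimes> (g \<otimes> h)"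
    and one_closed: "\<one> \<in> carrier A"
    and mult_one: "f \<in> carrier A \<Longrightarrow> f \<otimes> \<one> = f"
    and zero_mult: "0 \<otimes> f = 0"
    and mult_add: "f \<otimes> (g + h) = f \<otimes> g + f \<otimes> h"
    and mult_scale: "f \<otimes> scale_fun c g = scale_fun c (f \<otimes> g)"
begin

lemma abelian_group: "abelian_group A"
proof (rule abelian_groupI)
  fix x assume "x \<in> carrier A"
  then have "- x \<in> carrier A" "- x \<oplus> x = \<zero>"
    by (auto simp: carrier_eq add_eq zero_eq)
  then show "\<exists>y\<in>carrier A. y \<oplus> x = \<zero>"
    by blast
qed (auto simp: carrier_eq add_eq zero_eq algebra_simps)

sublocale abelian_group A
  by (rule abelian_group)

lemma subspace_carrier: "fun_space.subspace (carrier A)"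
  by (auto simp: fun_space.subspace_def carrier_eq)

lemma inv_eq: "x \<in> carrier A \<Longrightarrow> inv\<^bsub>add_monoid A\<^esub> x = - x"
  using add.inv_equality[of "- x" x] unfolding a_inv_def by (simp add: add_eq zero_eq carrier_eq)

text \<open>Trades the submodule of the record for a subspace of \<open>fun_space\<close>, which is
  closed under negation automatically.\<close>

lemma left_ideal_iff:
  "left_ideal I A \<longleftrightarrow> I \<subseteq> carrier A \<and> fun_space.subspace I \<and>
     (\<forall>a\<in>carrier A. \<forall>x\<in>I. a \<otimes> x \<in> I)"
proof -
  have "submodule I ring_of_type_algebra A \<longleftrightarrow> I \<subseteq> carrier A \<and> fun_space.subspace I"
  proof
    assume "submodule I ring_of_type_algebra A"
    then interpret submodule I ring_of_type_algebra A .
    show "I \<subseteq> carrier A \<and> fun_space.subspace I"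
      using subset one_closed m_closed smult_closed
      by (auto simp: fun_space.subspace_def add_eq zero_eq smult_eq ring_of_type_algebra_def)
  next
    assume I: "I \<subseteq> carrier A \<and> fun_space.subspace I"
    then have "inv\<^bsub>add_monoid A\<^esub> x \<in> I" if "x \<in> I" for x
      using that inv_eq[of x] fun_space.subspace_neg[of I x] by auto
    with I show "submodule I ring_of_type_algebra A"
      by (auto simp: submodule_def submodule_axioms_def subgroup_def fun_space.subspace_def
            add_eq zero_eq smult_eq)
  qed
  then show ?thesis
    by (auto simp: left_ideal_def)
qed

lemma finsum_eq_sum: "\<lbrakk>finite S; f \<in> S \<rightarrow> carrier A\<rbrakk> \<Longrightarrow> (\<Oplus>x\<in>S. f x) = sum f S"
  by (induction S rule: finite_induct) (auto simp: zero_eq add_eq Pi_iff)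

text \<open>A \<open>finsum\<close> in the record becomes an ordinary sum once its terms lie in the
  carrier; here they do, as each lies in a left ideal.\<close>

lemma semisimple_algebra_iff:
  "semisimple_algebra A \<longleftrightarrow>
     (\<exists>S. finite S \<and> (\<forall>L\<in>S. simple_left_ideal L A) \<and>
        (\<forall>a\<in>carrier A. \<exists>!f. f \<in> (\<Pi>\<^sub>E L\<in>S. L) \<and> a = sum f S))"
proof -
  have "(a = (\<Oplus>L\<in>S. f L)) \<longleftrightarrow> (a = sum f S)"
    if "finite S" "\<forall>L\<in>S. simple_left_ideal L A" "f \<in> (\<Pi>\<^sub>E L\<in>S. L)" for S a f
  proof -
    have "f L \<in> carrier A" if "L \<in> S" for L
      using PiE_mem[OF \<open>f \<in> (\<Pi>\<^sub>E L\<in>S. L)\<close> that] bspec[OF \<open>\<forall>L\<in>S. simple_left_ideal L A\<close> that]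
      by (auto simp: simple_left_ideal_def left_ideal_iff)
    then show ?thesis
      using finsum_eq_sum[OF that(1), of f] by simp
  qed
  then have "(f \<in> (\<Pi>\<^sub>E L\<in>S. L) \<and> a = (\<Oplus>L\<in>S. f L)) \<longleftrightarrow> (f \<in> (\<Pi>\<^sub>E L\<in>S. L) \<and> a = sum f S)"
    if "finite S" "\<forall>L\<in>S. simple_left_ideal L A" for S a f
    using that by (intro conj_cong refl)
  then show ?thesis
    unfolding semisimple_algebra_def by (simp cong: conj_cong)
qed

lemma left_ideal_sum: "\<lbrakk>left_ideal I A; \<And>x. x \<in> S \<Longrightarrow> f x \<in> I\<rbrakk> \<Longrightarrow> sum f S \<in> I"
  by (auto simp: left_ideal_iff intro: fun_space.subspace_sum)

text \<open>The left ideal of all \<open>z\<close> with \<open>y A z = 0\<close> contains every simple left ideal \<open>L\<close>: either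
  it contains \<open>L\<close> because it meets it, or \<open>y A L\<close> lies in the zero intersection.\<close>

lemma semisimple_imp_semiprime:
  assumes "semisimple_algebra A" and y: "y \<in> carrier A"
    and yay: "\<And>a. a \<in> carrier A \<Longrightarrow> y \<otimes> (a \<otimes> y) = 0"
  shows "y = 0"
proof -
  define N where "N = {z \<in> carrier A. \<forall>a\<in>carrier A. y \<otimes> (a \<otimes> z) = 0}"
  have mult_zero: "f \<otimes> 0 = 0" for f
    using mult_scale[of f 0 0] by (simp add: scale_fun_def zero_fun_def)
  have N: "left_ideal N A"
  proof -
    have "y \<otimes> (b \<otimes> (a \<otimes> z)) = 0" if "z \<in> N" "a \<in> carrier A" "b \<in> carrier A" for a b z
      using that by (simp add: N_def mult_assoc[symmetric] mult_closed)
    then show ?thesis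
      using subspace_carrier
      by (auto simp: left_ideal_iff N_def fun_space.subspace_def mult_add mult_scale mult_zero mult_closed)
  qed
  obtain S where S: "finite S" "\<And>L. L \<in> S \<Longrightarrow> simple_left_ideal L A"
      "\<And>a. a \<in> carrier A \<Longrightarrow> \<exists>f. f \<in> (\<Pi>\<^sub>E L\<in>S. L) \<and> a = sum f S"
    using assms(1) unfolding semisimple_algebra_iff by (metis (no_types, lifting))
  have "L \<subseteq> N" if "L \<in> S" for L
  proof -
    have L: "left_ideal L A" and simple: "\<And>J. \<lbrakk>left_ideal J A; J \<subseteq> L\<rbrakk> \<Longrightarrow> J = {0} \<or> J = L"
      using S(2)[OF that] by (auto simp: simple_left_ideal_def zero_eq)
    have "left_ideal (L \<inter> N) A"
      using L N by (auto simp: left_ideal_iff fun_space.subspace_inter)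
    from simple[OF this] consider "L \<inter> N = {0}" | "L \<inter> N = L"
      by auto
    then show ?thesis
    proof cases
      case 1
      have "y \<otimes> (a \<otimes> z) = 0" if "z \<in> L" "a \<in> carrier A" for a z
      proof -
        have z: "z \<in> carrier A"
          using L that by (auto simp: left_ideal_iff)
        have "y \<otimes> (a \<otimes> z) \<in> L"
          using L y that by (auto simp: left_ideal_iff)
        moreover have "y \<otimes> (b \<otimes> (y \<otimes> (a \<otimes> z))) = 0" if b: "b \<in> carrier A" for b
        proof -
          have "y \<otimes> (b \<otimes> (y \<otimes> (a \<otimes> z))) = (y \<otimes> (b \<otimes> y)) \<otimes> (a \<otimes> z)"
            using y b z \<open>a \<in> carrier A\<close> by (simp add: mult_assoc mult_closed)
          also have "\<dots> = 0 \<otimes> (a \<otimes> z)"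
            by (simp add: yay b)
          also have "\<dots> = 0"
            by (rule zero_mult)
          finally show ?thesis .
        qed
        ultimately have "y \<otimes> (a \<otimes> z) \<in> L \<inter> N"
          using y z \<open>a \<in> carrier A\<close> by (auto simp: N_def mult_closed)
        with 1 show ?thesis by auto
      qed
      with L show ?thesis
        by (auto simp: N_def left_ideal_iff)
    qed auto
  qed
  \<comment> \<open>The unit is a sum of elements of the ideals in \<open>S\<close>, hence lies in
    \<open>N\<close>; testing this with the unit for \<open>a\<close> leaves \<open>y\<close>
    itself.\<close>
  moreover obtain f where "f \<in> (\<Pi>\<^sub>E L\<in>S. L)" "\<one> = sum f S"
    using S(3) one_closed by blast
  ultimately have "\<one> \<in> N"
    using left_ideal_sum[OF N, of S f] by (auto simp: PiE_iff)
  then have "y \<otimes> (\<one> \<otimes> \<one>) = 0"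
    using one_closed by (auto simp: N_def)
  then show ?thesis
    using y one_closed by (simp add: mult_one)
qed

section \<open>Finite dimension of the algebra and of its left ideals\<close>

lemma finite_independent:
  assumes "fun_space.independent B" "B \<subseteq> carrier A"
  shows "finite B"
proof -
  define T where "T = (\<lambda>d e. if e = d then 1 else 0 :: complex) ` D"
  have "carrier A \<subseteq> fun_space.span T"
  proof
    fix f assume f: "f \<in> carrier A"
    have "f = (\<Sum>d\<in>D. scale_fun (f d) (\<lambda>e. if e = d then 1 else 0))"
      using f finite_basis
      by (auto simp: fun_eq_iff sum_fun_apply carrier_eq if_distrib[of "\<lambda>x. _ * x"] cong: if_cong)
    moreover have "\<dots> \<in> fun_space.span T"
      by (intro fun_space.span_sum fun_space.span_scale fun_space.span_base) (auto simp: T_def)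
    ultimately show "f \<in> fun_space.span T"
      by simp
  qed
  moreover have "finite T"
    using finite_basis by (simp add: T_def)
  ultimately show ?thesis
    using fun_space.independent_span_bound[of T B] assms by blast
qed

text \<open>Supplies the measure for the two inductions that split off left ideals: a basis of
  \<open>J\<close> extended by a vector outside \<open>J\<close> stays independent.\<close>

lemma dim_psubset:
  assumes "fun_space.subspace J" "fun_space.subspace I" "J \<subset> I" "I \<subseteq> carrier A"
  shows "fun_space.dim J < fun_space.dim I"
proof -
  obtain B where B: "B \<subseteq> J" "fun_space.independent B" "J \<subseteq> fun_space.span B" "card B = fun_space.dim J"
    using fun_space.basis_exists by blast
  obtain C where C: "C \<subseteq> I" "fun_space.independent C" "I \<subseteq> fun_space.span C" "card C = fun_space.dim I"
    using fun_space.basis_exists by blast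
  have finC: "finite C"
    using finite_independent[OF C(2)] C(1) assms(4) by auto
  obtain v where v: "v \<in> I" "v \<notin> J"
    using assms(3) by auto
  have "v \<notin> fun_space.span B"
    using v fun_space.span_minimal[OF B(1) assms(1)] by auto
  then have "fun_space.independent (insert v B)"
    using B(2) by (simp add: fun_space.independent_insertI)
  moreover have "insert v B \<subseteq> fun_space.span C"
    using B(1) assms(3) v C(3) by auto
  ultimately have "finite (insert v B) \<and> card (insert v B) \<le> card C"
    by (rule fun_space.independent_span_bound[OF finC])
  moreover have "v \<notin> B"
    using v B(1) by auto
  ultimately show ?thesis
    using B(4) C(4) by auto
qed

end

text \<open>A Hermitian form, linear in its first argument, for which the adjoint of a left
  multiplication is again a left multiplication. Positivity appears as the absence of isotropic
  vectors, which is what orthogonal projection needs.\<close>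

locale star_form = function_algebra +
  fixes F :: "('a \<Rightarrow> complex) \<Rightarrow> ('a \<Rightarrow> complex) \<Rightarrow> complex"
  assumes form_add: "F (x + y) z = F x z + F y z"
    and form_scale: "F (scale_fun c x) z = c * F x z"
    and form_cnj: "F x y = cnj (F y x)"
    and form_definite: "\<lbrakk>x \<in> carrier A; F x x = 0\<rbrakk> \<Longrightarrow> x = 0"
    and form_adjoint: "a \<in> carrier A \<Longrightarrow> \<exists>a'\<in>carrier A. \<forall>x\<in>carrier A. \<forall>y\<in>carrier A.
        F (a \<otimes> x) y = F x (a' \<otimes> y)"
begin

lemma form_add_right: "F z (x + y) = F z x + F z y"
  by (metis form_add form_cnj complex_cnj_add)

lemma form_scale_right: "F z (scale_fun c x) = cnj c * F z x"
  by (metis form_scale form_cnj complex_cnj_mult)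

lemma form_diff: "F (x - y) z = F x z - F y z"
  using form_add[of "x - y" y z] by simp

lemma form_zero: "F 0 z = 0" "F z 0 = 0"
  using form_add[of 0 0 z] form_add_right[of z 0 0] by simp_all

text \<open>Gram-Schmidt: a new vector \<open>v\<close> is first made orthogonal to the span of
  \<open>B\<close>, then the projection of \<open>a\<close> is corrected along the resulting
  \<open>w\<close>.\<close>

lemma projection_exists:
  assumes "finite B" "B \<subseteq> carrier A" "a \<in> carrier A"
  shows "\<exists>b\<in>fun_space.span B. \<forall>y\<in>fun_space.span B. F (a - b) y = 0"
  using assms
proof (induction B arbitrary: a rule: finite_induct)
  case empty
  show ?case
    unfolding fun_space.span_empty by (simp only: ball_simps bex_simps form_zero HOL.simp_thms)
next
  case (insert v B)
  have sub: "fun_space.span B \<subseteq> carrier A"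
    using fun_space.span_minimal[OF _ subspace_carrier] insert.prems by blast
  obtain v0 where v0: "v0 \<in> fun_space.span B" "\<And>y. y \<in> fun_space.span B \<Longrightarrow> F (v - v0) y = 0"
    using insert by (metis insert_subset)
  obtain b where b: "b \<in> fun_space.span B" "\<And>y. y \<in> fun_space.span B \<Longrightarrow> F (a - b) y = 0"
    using insert by (metis insert_subset)
  define w where "w = v - v0"
  have w: "w \<in> carrier A"
    using insert.prems v0(1) sub fun_space.subspace_diff[OF subspace_carrier] by (auto simp: w_def)
  have w_perp: "F w y = 0" "F y w = 0" if "y \<in> fun_space.span B" for y
    using v0(2)[OF that] form_cnj[of y w] by (auto simp: w_def)
  \<comment> \<open>The coefficient of \<open>a - b\<close> along \<open>w\<close>. If
    \<open>F w w\<close> is 0 then \<open>w = 0\<close>, and the next equation reads 0 = 0, so the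
    division by 0 does no harm.\<close>
  define c where "c = F (a - b) w / F w w"
  have c: "c * F w w = F (a - b) w"
    using form_definite[OF w] by (cases "F w w = 0") (auto simp: c_def form_zero)
  have "b + scale_fun c w \<in> fun_space.span (insert v B)"
    using b(1) v0(1) fun_space.span_mono[of B "insert v B"] unfolding w_def
    by (intro fun_space.span_add fun_space.span_scale fun_space.span_diff)
       (auto intro: fun_space.span_base)
  moreover have "F (a - (b + scale_fun c w)) y = 0" if "y \<in> fun_space.span (insert v B)" for y
  proof -
    obtain k where k: "y - scale_fun k v \<in> fun_space.span B"
      using \<open>y \<in> fun_space.span (insert v B)\<close> unfolding fun_space.span_insert by auto
    \<comment> \<open>Rewrites \<open>y\<close> as a vector of the span of \<open>B\<close> plus a
      multiple of \<open>w\<close> instead of \<open>v\<close>.\<close>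
    define z where "z = (y - scale_fun k v) + scale_fun k v0"
    have z: "z \<in> fun_space.span B"
      unfolding z_def using k v0(1) by (intro fun_space.span_add fun_space.span_scale)
    have y: "y = z + scale_fun k w"
      by (auto simp: z_def w_def fun_eq_iff algebra_simps)
    have "a - (b + scale_fun c w) = (a - b) - scale_fun c w"
      by (simp add: algebra_simps)
    then have "F (a - (b + scale_fun c w)) u = F (a - b) u - c * F w u" for u
      by (simp only: form_diff form_scale)
    then have "F (a - (b + scale_fun c w)) z = 0" "F (a - (b + scale_fun c w)) w = 0"
      using z b(2) w_perp c by simp_all
    then show ?thesis
      by (simp add: y form_add_right form_scale_right)
  qed
  ultimately show ?case
    by blast
qed

text \<open>\<open>K\<close> is the orthogonal complement of \<open>L\<close> inside
  \<open>I\<close>. It absorbs multiplication because \<open>a\<close> moves across the form as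
  \<open>a'\<close>, which maps \<open>L\<close> into itself; projecting onto \<open>L\<close> gives
  the decomposition of an element.\<close>

lemma left_ideal_complement:
  assumes I: "left_ideal I A" and L: "left_ideal L A" "L \<subseteq> I"
  obtains K where "left_ideal K A" "K \<subseteq> I" "K \<inter> L = {0}" "\<And>a. a \<in> I \<Longrightarrow> \<exists>l\<in>L. a - l \<in> K"
proof -
  define K where "K = {a \<in> I. \<forall>y\<in>L. F a y = 0}"
  have Lc: "L \<subseteq> carrier A" "fun_space.subspace L" and Ic: "I \<subseteq> carrier A" "fun_space.subspace I"
    using I L by (auto simp: left_ideal_iff)
  have mult: "F (a \<otimes> x) y = 0" if a: "a \<in> carrier A" and xy: "x \<in> K" "y \<in> L" for a x y
  proof -
    obtain a' where a': "a' \<in> carrier A"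
        "\<And>x y. \<lbrakk>x \<in> carrier A; y \<in> carrier A\<rbrakk> \<Longrightarrow> F (a \<otimes> x) y = F x (a' \<otimes> y)"
      using form_adjoint[OF a] by blast
    have "a' \<otimes> y \<in> L"
      using L a'(1) xy by (auto simp: left_ideal_iff)
    moreover have "x \<in> carrier A" "y \<in> carrier A"
      using xy Lc Ic by (auto simp: K_def)
    ultimately show ?thesis
      using a'(2) xy(1) by (simp add: K_def)
  qed
  have K: "left_ideal K A"
    using I mult by (auto simp: left_ideal_iff K_def fun_space.subspace_def form_add form_scale form_zero)
  have "K \<inter> L = {0}"
    using form_definite Lc(1) fun_space.subspace_0[OF Lc(2)] fun_space.subspace_0[OF Ic(2)]
    by (auto simp: K_def form_zero)
  moreover have "\<exists>l\<in>L. a - l \<in> K" if "a \<in> I" for a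
  proof -
    obtain B where B: "B \<subseteq> L" "fun_space.independent B" "L \<subseteq> fun_space.span B"
      using fun_space.maximal_independent_subset[of L] by metis
    have "finite B"
      using finite_independent[OF B(2)] B(1) Lc(1) by auto
    moreover have "fun_space.span B = L"
      using B fun_space.span_minimal[OF _ Lc(2)] by blast
    ultimately obtain b where "b \<in> L" "\<forall>y\<in>L. F (a - b) y = 0"
      using projection_exists[of B a] B(1) Lc Ic \<open>a \<in> I\<close> by auto
    moreover from this have "a - b \<in> I"
      using \<open>a \<in> I\<close> L(2) fun_space.subspace_diff[OF Ic(2)] by auto
    ultimately show ?thesis
      by (auto simp: K_def)
  qed
  moreover have "K \<subseteq> I"
    by (auto simp: K_def)
  ultimately show ?thesis
    by (intro that[OF K])
qed

lemma contains_simple_left_ideal: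
  "\<lbrakk>left_ideal I A; I \<noteq> {0}\<rbrakk> \<Longrightarrow> \<exists>L\<subseteq>I. simple_left_ideal L A"
proof (induction "fun_space.dim I" arbitrary: I rule: less_induct)
  case less
  show ?case
  proof (cases "simple_left_ideal I A")
    case False
    then obtain J where J: "left_ideal J A" "J \<subset> I" "J \<noteq> {0}"
      using less.prems by (auto simp: simple_left_ideal_def zero_eq)
    with less.prems have "fun_space.dim J < fun_space.dim I"
      by (intro dim_psubset) (auto simp: left_ideal_iff)
    with less.hyps J show ?thesis
      by (meson dual_order.trans psubset_imp_subset)
  qed auto
qed

text \<open>Split off a simple left ideal \<open>L\<close> and decompose a complement
  \<open>K\<close>, of smaller dimension, by induction.\<close>

lemma left_ideal_decomposition:
  "left_ideal I A \<Longrightarrow> \<exists>S. finite S \<and> (\<forall>L\<in>S. simple_left_ideal L A \<and> L \<subseteq> I) \<and>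
     (\<forall>a\<in>I. \<exists>!f. f \<in> (\<Pi>\<^sub>E L\<in>S. L) \<and> a = sum f S)"
proof (induction "fun_space.dim I" arbitrary: I rule: less_induct)
  case less
  show ?case
  proof (cases "I = {0}")
    case True
    then show ?thesis
      by (intro exI[of _ "{}"]) auto
  next
    case False
    then obtain L where L: "L \<subseteq> I" "simple_left_ideal L A"
      using contains_simple_left_ideal less.prems by blast
    then have L': "left_ideal L A" "L \<noteq> {0}"
      by (auto simp: simple_left_ideal_def zero_eq)
    obtain K where K: "left_ideal K A" "K \<subseteq> I" "K \<inter> L = {0}" "\<And>a. a \<in> I \<Longrightarrow> \<exists>l\<in>L. a - l \<in> K"
      using left_ideal_complement[OF less.prems L'(1) L(1)] by metis
    have spaces: "fun_space.subspace I" "fun_space.subspace L" "fun_space.subspace K" "0 \<in> L"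
      using less.prems L' K by (auto simp: left_ideal_iff fun_space.subspace_0)
    have "K \<noteq> I"
      using K(3) L(1) L'(2) by auto
    then have "fun_space.dim K < fun_space.dim I"
      using K less.prems by (intro dim_psubset) (auto simp: left_ideal_iff)
    then obtain S where S: "finite S" "\<forall>J\<in>S. simple_left_ideal J A \<and> J \<subseteq> K"
        "\<forall>a\<in>K. \<exists>!f. f \<in> (\<Pi>\<^sub>E J\<in>S. J) \<and> a = sum f S"
      using less.hyps[OF _ K(1)] by auto
    \<comment> \<open>The members of \<open>S\<close> lie in \<open>K\<close>, which meets
      \<open>L\<close> only in 0. This makes \<open>L\<close> a genuinely new summand.\<close>
    have "L \<notin> S"
      using S(2) K(3) L'(2) by blast
    have sum_K: "sum f S \<in> K" if "f \<in> (\<Pi>\<^sub>E J\<in>insert L S. J)" for f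
      using left_ideal_sum[OF K(1), of S f] that S(2) by (auto simp: PiE_iff)
    have sum_insert: "sum f (insert L S) = f L + sum f S" for f :: "('a \<Rightarrow> complex) set \<Rightarrow> 'a \<Rightarrow> complex"
      using S(1) \<open>L \<notin> S\<close> by simp
    have "\<exists>!f. f \<in> (\<Pi>\<^sub>E J\<in>insert L S. J) \<and> a = sum f (insert L S)" if "a \<in> I" for a
    proof (rule ex_ex1I)
      obtain l where l: "l \<in> L" "a - l \<in> K"
        using K(4)[OF \<open>a \<in> I\<close>] by blast
      obtain g where g: "g \<in> (\<Pi>\<^sub>E J\<in>S. J)" "a - l = sum g S"
        using bspec[OF S(3) l(2)] by blast
      have "sum (g(L := l)) S = sum g S"
        using \<open>L \<notin> S\<close> by (intro sum.cong) auto
      then have "a = sum (g(L := l)) (insert L S)"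
        using g(2) by (simp add: sum_insert algebra_simps)
      moreover have "g(L := l) \<in> (\<Pi>\<^sub>E J\<in>insert L S. J)"
        using g(1) l(1) by (auto simp: PiE_iff extensional_def)
      ultimately show "\<exists>f. f \<in> (\<Pi>\<^sub>E J\<in>insert L S. J) \<and> a = sum f (insert L S)"
        by blast
    next
      fix f g
      assume f: "f \<in> (\<Pi>\<^sub>E J\<in>insert L S. J) \<and> a = sum f (insert L S)"
        and g: "g \<in> (\<Pi>\<^sub>E J\<in>insert L S. J) \<and> a = sum g (insert L S)"
      \<comment> \<open>A vector of \<open>L\<close> that equals a vector of \<open>K\<close> is 0,
        so the components in \<open>L\<close> agree and uniqueness in \<open>K\<close> does the
        rest.\<close>
      have "f L - g L = sum g S - sum f S"
        using f g sum_insert[of f] sum_insert[of g] by (simp add: algebra_simps)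
      moreover have "f L - g L \<in> L"
        using f g fun_space.subspace_diff[OF spaces(2)] by (auto simp: PiE_iff)
      moreover have "sum g S - sum f S \<in> K"
        using f g fun_space.subspace_diff[OF spaces(3)] sum_K by metis
      ultimately have "f L - g L \<in> {0}" "sum g S - sum f S \<in> {0}"
        using K(3) by (metis IntI)+
      then have eq: "f L = g L" "sum f S = sum g S"
        by simp_all
      \<comment> \<open>Uniqueness for \<open>S\<close> concerns functions extensional on
        \<open>S\<close>, hence the restriction.\<close>
      have restr: "restrict u S \<in> (\<Pi>\<^sub>E J\<in>S. J)" "sum (restrict u S) S = sum u S"
        if "u \<in> (\<Pi>\<^sub>E J\<in>insert L S. J)" for u
        using that by (auto simp: PiE_iff)
      have "restrict f S = restrict g S"
        using bspec[OF S(3) sum_K[of f]] restr[of f] restr[of g] f g eq(2)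
        by (smt (verit, ccfv_threshold))
      then have "f J = g J" if "J \<in> S" for J
        using that by (metis restrict_apply')
      with eq(1) have "f J = g J" if "J \<in> insert L S" for J
        using that by blast
      then show "f = g"
        using f g by (intro PiE_ext[of f "insert L S" "\<lambda>J. J" g]) auto
    qed
    moreover have "finite (insert L S)" "\<forall>J\<in>insert L S. simple_left_ideal J A \<and> J \<subseteq> I"
      using S(1,2) L K(2) by auto
    ultimately show ?thesis
      by (intro exI[of _ "insert L S"] conjI) auto
  qed
qed

lemma semisimple: "semisimple_algebra A"
proof -
  have "left_ideal (carrier A) A"
    by (auto simp: left_ideal_iff subspace_carrier mult_closed)
  then show ?thesis
    using left_ideal_decomposition[of "carrier A"] unfolding semisimple_algebra_iff by auto
qed

end

section \<open>Composition of diagrams in terms of colorings\<close>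

text \<open>With partitions seen as equivalence relations, refinement is inclusion; the sums over
  refinements below are indexed this way.\<close>

definition same_block :: "'a set set \<Rightarrow> ('a \<times> 'a) set" where
  "same_block P = {(u, v). \<exists>B\<in>P. u \<in> B \<and> v \<in> B}"

text \<open>Stated for an arbitrary family of sets, as it is also applied to
  \<open>stacked_blocks\<close>, whose members overlap in the middle row.\<close>

definition compatible :: "'a set set \<Rightarrow> ('a \<Rightarrow> 'c) \<Rightarrow> bool" where
  "compatible P g \<longleftrightarrow> (\<forall>(u, v)\<in>same_block P. g u = g v)"

lemma compatible_iff: "compatible P g \<longleftrightarrow> (\<forall>B\<in>P. \<forall>u\<in>B. \<forall>v\<in>B. g u = g v)"
  by (auto simp: compatible_def same_block_def)

lemma compatibleD: "\<lbrakk>compatible P g; B \<in> P; u \<in> B; v \<in> B\<rbrakk> \<Longrightarrow> g u = g v"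
  unfolding compatible_iff by blast

lemma compatible_cong:
  "\<lbrakk>partition_on A P; \<And>x. x \<in> A \<Longrightarrow> f x = g x\<rbrakk> \<Longrightarrow> compatible P f \<longleftrightarrow> compatible P g"
  unfolding compatible_iff using partition_onD1[of A P] by (metis UnionI)

lemma equiv_same_block: "partition_on A P \<Longrightarrow> equiv A (same_block P)"
  unfolding same_block_def by (rule equiv_partition_on)

lemma partition_on_same_block: "partition_on A P \<Longrightarrow> P = A // same_block P"
  unfolding same_block_def by (rule partition_on_eq_quotient[symmetric])

lemma same_block_quotient:
  assumes r: "equiv A r"
  shows "same_block (A // r) = r"
proof (intro subset_antisym subrelI)
  fix u v assume "(u, v) \<in> same_block (A // r)"
  then obtain x where "(x, u) \<in> r" "(x, v) \<in> r"
    unfolding same_block_def quotient_def by blast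
  then show "(u, v) \<in> r"
    using r by (meson equivE symD transD)
next
  fix u v assume uv: "(u, v) \<in> r"
  then have "u \<in> A"
    using r by (metis equiv_class_eq_iff)
  then have "u \<in> r `` {u}" "v \<in> r `` {u}" "r `` {u} \<in> A // r"
    using equiv_class_self[OF r] uv by (auto intro: quotientI)
  then show "(u, v) \<in> same_block (A // r)"
    unfolding same_block_def by blast
qed

lemma same_block_image_eq:
  assumes "partition_on A P" "B \<in> P" "x \<in> B"
  shows "same_block P `` {x} = B"
  using assms by (auto simp: same_block_def partition_on_def disjoint_def)

lemma partition_on_eqI:
  assumes "partition_on A P" "partition_on A Q" "same_block P = same_block Q"
  shows "P = Q"
  using assms partition_on_same_block by metis

text \<open>The indicator of the block of \<open>u\<close> is compatible, so two colors suffice to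
  recover a partition.\<close>

lemma same_block_iff_compatible:
  assumes P: "partition_on A P" and uv: "u \<in> A" "v \<in> A"
  shows "(u, v) \<in> same_block P \<longleftrightarrow>
     (\<forall>g. range g \<subseteq> {..<2::nat} \<and> compatible P g \<longrightarrow> g u = g v)"
proof
  assume *: "\<forall>g. range g \<subseteq> {..<2::nat} \<and> compatible P g \<longrightarrow> g u = g v"
  define g :: "'a \<Rightarrow> nat" where "g x = (if (u, x) \<in> same_block P then 1 else 0)" for x
  have "range g \<subseteq> {..<2}"
    by (auto simp: g_def)
  moreover have "compatible P g"
    using equiv_same_block[OF P] by (auto simp: compatible_def g_def equiv_def dest: symD transD)
  ultimately have "g u = g v"
    using * by simp
  moreover have "g u = 1"
    using equiv_same_block[OF P] uv by (auto simp: g_def equiv_def refl_on_def)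
  ultimately have "g v \<noteq> 0"
    by simp
  then show "(u, v) \<in> same_block P"
    unfolding g_def by meson
qed (unfold compatible_def, blast)

text \<open>A compatible coloring that extends \<open>h\<close> is the same as a color for each block, where the color
  of a block that meets \<open>Y\<close> is forced.\<close>

lemma card_compatible_extensions:
  fixes h :: "'a \<Rightarrow> nat"
  assumes fin: "finite V" and P: "partition_on V P" and Y: "Y \<subseteq> V"
    and h: "h \<in> Y \<rightarrow> {..<N}" and hP: "\<And>B u v. \<lbrakk>B \<in> P; u \<in> B \<inter> Y; v \<in> B \<inter> Y\<rbrakk> \<Longrightarrow> h u = h v"
  shows "card {g \<in> V \<rightarrow>\<^sub>E {..<N}. compatible P g \<and> (\<forall>y\<in>Y. g y = h y)} = N ^ card {B \<in> P. B \<inter> Y = {}}"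
proof -
  define r where "r B = (SOME x. x \<in> B)" for B :: "'a set"
  define T where "T B = (if B \<inter> Y = {} then {..<N} else h ` (B \<inter> Y))" for B
  have finP: "finite P"
    using fin P by (rule finite_elements)
  have r: "r B \<in> B" if "B \<in> P" for B
    using partition_onD3[OF P] that unfolding r_def by (metis some_in_eq)
  have V: "V = \<Union>P"
    using P by (rule partition_onD1)
  have blk: "same_block P `` {x} = B" if "B \<in> P" "x \<in> B" for B x
    using same_block_image_eq[OF P that] .
  have blk_in: "same_block P `` {x} \<in> P" "x \<in> same_block P `` {x}" if "x \<in> V" for x
    using that blk unfolding V by (metis UnionE)+
  have "bij_betw (\<lambda>g. \<lambda>B\<in>P. g (r B))
      {g \<in> V \<rightarrow>\<^sub>E {..<N}. compatible P g \<and> (\<forall>y\<in>Y. g y = h y)} (PiE P T)"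
    (is "bij_betw ?f ?G _")
  proof (rule bij_betw_byWitness[where f' = "\<lambda>\<phi>. \<lambda>x\<in>V. \<phi> (same_block P `` {x})"])
    show "\<forall>g\<in>?G. (\<lambda>x\<in>V. ?f g (same_block P `` {x})) = g"
    proof
      fix g assume g: "g \<in> ?G"
      have "g (r (same_block P `` {x})) = g x" if "x \<in> V" for x
        using g blk_in[OF that] r by (auto elim!: compatibleD)
      then show "(\<lambda>x\<in>V. ?f g (same_block P `` {x})) = g"
        using g blk_in by (auto simp: fun_eq_iff PiE_def extensional_def)
    qed
    show "\<forall>\<phi>\<in>PiE P T. ?f (\<lambda>x\<in>V. \<phi> (same_block P `` {x})) = \<phi>"
    proof
      fix \<phi> assume \<phi>: "\<phi> \<in> PiE P T"
      have "same_block P `` {r B} = B" "r B \<in> V" if "B \<in> P" for B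
        using blk[OF that r[OF that]] r[OF that] that V by auto
      then show "?f (\<lambda>x\<in>V. \<phi> (same_block P `` {x})) = \<phi>"
        using \<phi> by (auto simp: fun_eq_iff PiE_def extensional_def)
    qed
    show "?f ` ?G \<subseteq> PiE P T"
    proof (rule image_subsetI)
      fix g assume g: "g \<in> ?G"
      have "g (r B) \<in> T B" if B: "B \<in> P" for B
      proof (cases "B \<inter> Y = {}")
        case True
        then show ?thesis
          using g r[OF B] B V by (auto simp: T_def PiE_iff)
      next
        case False
        then obtain y where y: "y \<in> B" "y \<in> Y"
          by auto
        have "compatible P g"
          using g by auto
        then have "g (r B) = g y"
          using B r[OF B] y(1) by (rule compatibleD)
        then show ?thesis
          using g y by (auto simp: T_def)
      qed
      then show "?f g \<in> PiE P T"
        by auto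
    qed
    show "(\<lambda>\<phi>. \<lambda>x\<in>V. \<phi> (same_block P `` {x})) ` PiE P T \<subseteq> ?G"
    proof (rule image_subsetI)
      fix \<phi> assume \<phi>: "\<phi> \<in> PiE P T"
      define g where "g = (\<lambda>x\<in>V. \<phi> (same_block P `` {x}))"
      have T: "T B \<subseteq> {..<N}" for B
        using h by (auto simp: T_def)
      have "g \<in> V \<rightarrow>\<^sub>E {..<N}"
        using \<phi> T blk_in(1) unfolding g_def by (fastforce simp: PiE_iff)
      moreover have "compatible P g"
        using blk V by (auto simp: compatible_iff g_def)
      moreover have "g y = h y" if "y \<in> Y" for y
      proof -
        have y: "y \<in> V"
          using that Y by auto
        note B = blk_in[OF y]
        have "\<phi> (same_block P `` {y}) \<in> T (same_block P `` {y})"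
          using \<phi> B(1) by (rule PiE_mem)
        also have "T (same_block P `` {y}) = h ` (same_block P `` {y} \<inter> Y)"
          using B(2) that by (auto simp: T_def)
        finally obtain u where u: "u \<in> same_block P `` {y} \<inter> Y" "\<phi> (same_block P `` {y}) = h u"
          by blast
        have "h u = h y"
          using B that u(1) by (intro hP[OF B(1)]) auto
        then show ?thesis
          using u(2) y by (simp add: g_def)
      qed
      ultimately show "(\<lambda>x\<in>V. \<phi> (same_block P `` {x})) \<in> ?G"
        unfolding g_def by blast
    qed
  qed
  then have "card ?G = card (PiE P T)"
    by (rule bij_betw_same_card)
  also have "\<dots> = (\<Prod>B\<in>P. card (T B))"
    using finP by (rule card_PiE)
  also have "\<dots> = (\<Prod>B\<in>P. if B \<inter> Y = {} then N else 1)"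
  proof (rule prod.cong[OF refl])
    fix B assume B: "B \<in> P"
    show "card (T B) = (if B \<inter> Y = {} then N else 1)"
    proof (cases "B \<inter> Y = {}")
      case False
      then obtain y where y: "y \<in> B \<inter> Y"
        by auto
      then have "h ` (B \<inter> Y) = {h y}"
        using hP[OF B] by blast
      with False show ?thesis
        by (simp add: T_def)
    qed (simp add: T_def)
  qed
  also have "\<dots> = N ^ card {B \<in> P. B \<inter> Y = {}}"
    using finP by (simp add: prod.If_cases Int_def)
  finally show ?thesis .
qed

section \<open>Connected components of two stacked diagrams and the count of middle
  colorings\<close>

definition stacked_vertices :: "nat \<Rightarrow> stacked_vertex set" where
  "stacked_vertices m = Top ` {1..m} \<union> Mid ` {1..m} \<union> Bot ` {1..m}"

text \<open>Equality of colors spreads along chains of overlapping blocks, so a coloring is constant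
  on components as soon as it is constant on the stacked blocks.\<close>

lemma partition_on_components:
  assumes "partition_on (vertices m) d1" "partition_on (vertices m) d2"
  shows "partition_on (stacked_vertices m) (components d1 d2)"
    and "compatible (components d1 d2) g \<longleftrightarrow> compatible (stacked_blocks d1 d2) g"
proof -
  define r where "r = (same_block (stacked_blocks d1 d2))\<^sup>*"
  define V where "V = stacked_vertices m"
  have "\<Union>(stacked_blocks d1 d2) = (case_sum Top Mid) ` \<Union>d1 \<union> (case_sum Mid Bot) ` \<Union>d2"
    by (auto simp: stacked_blocks_def)
  also have "\<dots> = V"
    unfolding partition_onD1[OF assms(1), symmetric] partition_onD1[OF assms(2), symmetric]
    by (auto simp: V_def stacked_vertices_def vertices_def image_Un image_image)
  finally have V: "\<Union>(stacked_blocks d1 d2) = V" .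
  \<comment> \<open>The closure in \<open>components\<close> is reflexive on the whole type. Its
    classes of stacked vertices never leave \<open>V\<close>, so they are also the classes of its
    restriction to \<open>V\<close>, which is an equivalence on \<open>V\<close>.\<close>
  have stay: "y \<in> V" if "(x, y) \<in> r" "x \<in> V" for x y
    using that unfolding r_def by induction (auto simp: same_block_def simp flip: V)
  have "sym r"
    unfolding r_def by (intro sym_rtrancl) (auto simp: sym_def same_block_def)
  then have equiv: "equiv V (r \<inter> V \<times> V)"
    by (auto simp: equiv_def refl_on_def sym_def trans_def r_def intro: rtrancl_trans)
  have comp: "components d1 d2 = V // (r \<inter> V \<times> V)"
    using stay unfolding components_def V quotient_def r_def same_block_def by blast
  show "partition_on (stacked_vertices m) (components d1 d2)"
    unfolding comp V_def[symmetric] using equiv by (rule partition_on_quotient)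
  have blocks: "same_block (components d1 d2) = r \<inter> V \<times> V"
    unfolding comp using equiv by (rule same_block_quotient)
  show "compatible (components d1 d2) g \<longleftrightarrow> compatible (stacked_blocks d1 d2) g"
  proof
    assume "compatible (components d1 d2) g"
    moreover have "same_block (stacked_blocks d1 d2) \<subseteq> r \<inter> V \<times> V"
      by (auto simp: r_def same_block_def simp flip: V)
    ultimately show "compatible (stacked_blocks d1 d2) g"
      unfolding compatible_def blocks by blast
  next
    assume g: "compatible (stacked_blocks d1 d2) g"
    have "g x = g y" if "(x, y) \<in> r" for x y
      using that unfolding r_def by induction (use g in \<open>auto simp: compatible_def\<close>)
    then show "compatible (components d1 d2) g"
      unfolding compatible_def blocks by auto
  qed
qed

lemma compatible_stacked_blocks:
  "compatible (stacked_blocks d1 d2) (case_stacked_vertex t c b) \<longleftrightarrow>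
     compatible d1 (case_sum t c) \<and> compatible d2 (case_sum c b)"
proof -
  have "case_stacked_vertex t c b (case_sum Top Mid x) = case_sum t c x"
       "case_stacked_vertex t c b (case_sum Mid Bot x) = case_sum c b x" for x
    by (auto split: sum.split)
  then show ?thesis
    by (auto simp: compatible_iff stacked_blocks_def ball_Un)
qed

text \<open>The composition is the partition into components pulled back along
  \<open>case_sum Top Bot\<close>; the components with empty preimage are exactly those in the
  middle row.\<close>

lemma partition_on_compose:
  assumes "partition_on (vertices m) d1" "partition_on (vertices m) d2"
  shows "partition_on (vertices m) (compose_diagrams d1 d2)"
proof -
  let ?f = "case_sum Top Bot"
  have "?f -` stacked_vertices m = vertices m"
    by (auto simp: stacked_vertices_def vertices_def split: sum.splits)
  moreover have "?f -` C = {} \<longleftrightarrow> C \<subseteq> range Mid" for C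
  proof
    assume C: "?f -` C = {}"
    show "C \<subseteq> range Mid"
    proof
      fix x assume "x \<in> C"
      with C have "?f (Inl i) \<noteq> x" "?f (Inr i) \<noteq> x" for i
        by blast+
      then show "x \<in> range Mid"
        by (cases x) auto
    qed
  qed (auto split: sum.splits)
  then have "compose_diagrams d1 d2 = (-`) ?f ` components d1 d2 - {{}}"
    by (auto simp: compose_diagrams_def)
  ultimately show ?thesis
    using partition_on_vimage[OF partition_on_components(1)[OF assms], of ?f] by simp
qed

abbreviation colorings :: "nat \<Rightarrow> nat \<Rightarrow> (nat \<Rightarrow> nat) set" where
  "colorings N m \<equiv> {1..m} \<rightarrow>\<^sub>E {..<N}"

text \<open>A middle coloring completes \<open>t\<close> and \<open>b\<close> to a coloring of the
  whole stack, and it fits both diagrams iff the result is constant on components. A component that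
  reaches the outer rows has a forced color, consistently so iff \<open>t\<close> and
  \<open>b\<close> fit the composition; each removed component takes any of \<open>N\<close>
  colors.\<close>

lemma card_middle_colorings:
  assumes d: "partition_on (vertices m) d1" "partition_on (vertices m) d2"
    and t: "t \<in> colorings N m" and b: "b \<in> colorings N m"
  shows "card {c \<in> colorings N m. compatible d1 (case_sum t c) \<and> compatible d2 (case_sum c b)} =
     (if compatible (compose_diagrams d1 d2) (case_sum t b) then N ^ removed d1 d2 else 0)"
proof -
  define V where "V = stacked_vertices m"
  define Y where "Y = Top ` {1..m} \<union> Bot ` {1..m}"
  \<comment> \<open>The value 0 on the middle row is a dummy; \<open>h\<close> is only read on
    \<open>Y\<close>.\<close>
  define h where "h = case_stacked_vertex t (\<lambda>_. 0) b"
  define C where "C = components d1 d2"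
  note C = partition_on_components[OF d, folded C_def V_def]
  have CV: "B \<subseteq> V" if "B \<in> C" for B
    using partition_onD1[OF C(1)] that by auto
  have BY: "B \<inter> Y = B - range Mid" if "B \<in> C" for B
    using CV[OF that] by (auto simp: V_def stacked_vertices_def Y_def)
  have compose: "compatible (compose_diagrams d1 d2) (case_sum t b) \<longleftrightarrow>
      (\<forall>B\<in>C. \<forall>u\<in>B \<inter> Y. \<forall>v\<in>B \<inter> Y. h u = h v)"
  proof -
    have h: "case_sum t b x = h (case_sum Top Bot x)" for x
      by (auto simp: h_def split: sum.split)
    have img: "case_sum Top Bot ` (case_sum Top Bot -` B) = B \<inter> Y" if "B \<in> C" for B
    proof -
      have "range (case_sum Top Bot) = range Top \<union> range Bot"
        unfolding UNIV_sum image_Un image_image by simp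
      also have "\<dots> = - range Mid"
        by auto (metis rangeI stacked_vertex.exhaust)
      finally show ?thesis
        unfolding BY[OF that] by (auto simp: image_vimage_eq)
    qed
    have "compatible (compose_diagrams d1 d2) (case_sum t b) \<longleftrightarrow>
      (\<forall>B\<in>C. \<not> B \<subseteq> range Mid \<longrightarrow> (\<forall>u\<in>case_sum Top Bot ` (case_sum Top Bot -` B).
         \<forall>v\<in>case_sum Top Bot ` (case_sum Top Bot -` B). h u = h v))"
    proof -
      have "compatible (compose_diagrams d1 d2) (case_sum t b) \<longleftrightarrow>
        (\<forall>B\<in>C. \<not> B \<subseteq> range Mid \<longrightarrow> (\<forall>u\<in>case_sum Top Bot -` B. \<forall>v\<in>case_sum Top Bot -` B.
           case_sum t b u = case_sum t b v))"
        unfolding compatible_iff compose_diagrams_def C_def by (simp only: Ball_def mem_Collect_eq) metis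
      then show ?thesis
        unfolding h ball_simps by simp
    qed
    also have "\<dots> \<longleftrightarrow> (\<forall>B\<in>C. \<forall>u\<in>B \<inter> Y. \<forall>v\<in>B \<inter> Y. h u = h v)"
      using img BY by (metis Diff_eq_empty_iff empty_iff)
    finally show ?thesis .
  qed
  have case_Y: "(\<forall>y\<in>Y. case_stacked_vertex t c b y = h y)" for c
    by (auto simp: Y_def h_def)
  have split: "g = restrict (case_stacked_vertex t (\<lambda>i\<in>{1..m}. g (Mid i)) b) V"
    if "g \<in> V \<rightarrow>\<^sub>E {..<N}" "\<forall>y\<in>Y. g y = h y" for g
  proof
    fix x
    show "g x = restrict (case_stacked_vertex t (\<lambda>i\<in>{1..m}. g (Mid i)) b) V x"
    proof (cases "x \<in> V")
      case True
      then consider "x \<in> Y" | i where "i \<in> {1..m}" "x = Mid i"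
        by (auto simp: V_def Y_def stacked_vertices_def)
      then show ?thesis
      proof cases
        case 1
        then have "g x = h x"
          using that(2) by blast
        with 1 True show ?thesis
          by (auto simp: Y_def h_def)
      qed (use True in simp)
    next
      case False
      then show ?thesis
        by (simp add: PiE_arb[OF that(1) False])
    qed
  qed
  have "bij_betw (\<lambda>c. restrict (case_stacked_vertex t c b) V)
      {c \<in> colorings N m. compatible d1 (case_sum t c) \<and> compatible d2 (case_sum c b)}
      {g \<in> V \<rightarrow>\<^sub>E {..<N}. compatible C g \<and> (\<forall>y\<in>Y. g y = h y)}" (is "bij_betw ?f ?A ?G")
  proof (rule bij_betw_byWitness[where f' = "\<lambda>g. \<lambda>i\<in>{1..m}. g (Mid i)"])
    have restr: "compatible C (restrict g V) \<longleftrightarrow> compatible C g" for g :: "stacked_vertex \<Rightarrow> nat"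
      using C(1) by (rule compatible_cong) auto
    show "\<forall>c\<in>?A. (\<lambda>i\<in>{1..m}. ?f c (Mid i)) = c"
      by (auto simp: fun_eq_iff V_def stacked_vertices_def PiE_def extensional_def)
    show "\<forall>g\<in>?G. ?f (\<lambda>i\<in>{1..m}. g (Mid i)) = g"
    proof
      fix g assume "g \<in> ?G"
      then have "g \<in> V \<rightarrow>\<^sub>E {..<N}" "\<forall>y\<in>Y. g y = h y"
        by simp_all
      from split[OF this] show "?f (\<lambda>i\<in>{1..m}. g (Mid i)) = g"
        by (rule sym)
    qed
    show "?f ` ?A \<subseteq> ?G"
    proof (rule image_subsetI)
      fix c assume c: "c \<in> ?A"
      have "case_stacked_vertex t c b x < N" if "x \<in> V" for x
        using that t b c by (auto simp: V_def stacked_vertices_def PiE_iff)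
      moreover have "?f c y = h y" if "y \<in> Y" for y
        using that by (auto simp: V_def stacked_vertices_def Y_def h_def)
      moreover have "compatible C (?f c)"
        using c by (simp only: restr mem_Collect_eq) (simp add: C(2) compatible_stacked_blocks)
      ultimately show "?f c \<in> ?G"
        by simp
    qed
    show "(\<lambda>g. \<lambda>i\<in>{1..m}. g (Mid i)) ` ?G \<subseteq> ?A"
    proof (rule image_subsetI)
      fix g assume g: "g \<in> ?G"
      define c where "c = (\<lambda>i\<in>{1..m}. g (Mid i))"
      have "g \<in> V \<rightarrow>\<^sub>E {..<N}" "\<forall>y\<in>Y. g y = h y" and C_g: "compatible C g"
        using g by simp_all
      from C_g split[OF this(1,2), folded c_def] have "compatible C (restrict (case_stacked_vertex t c b) V)"
        by (rule back_subst)
      then have "compatible d1 (case_sum t c) \<and> compatible d2 (case_sum c b)"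
        by (simp only: restr) (simp add: C(2) compatible_stacked_blocks)
      moreover have "c \<in> colorings N m"
        using g by (auto simp: c_def V_def stacked_vertices_def PiE_iff)
      ultimately show "(\<lambda>i\<in>{1..m}. g (Mid i)) \<in> ?A"
        by (simp add: c_def)
    qed
  qed
  then have card: "card ?A = card ?G"
    by (rule bij_betw_same_card)
  show ?thesis
  proof (cases "compatible (compose_diagrams d1 d2) (case_sum t b)")
    case True
    have "card ?G = N ^ card {B \<in> C. B \<inter> Y = {}}"
    proof (rule card_compatible_extensions[OF _ C(1)])
      show "finite V" "Y \<subseteq> V"
        by (auto simp: V_def Y_def stacked_vertices_def)
      show "h \<in> Y \<rightarrow> {..<N}"
        using t b by (auto simp: Y_def h_def)
      fix B u v assume "B \<in> C" "u \<in> B \<inter> Y" "v \<in> B \<inter> Y"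
      then show "h u = h v"
        using True unfolding compose by metis
    qed
    also have "{B \<in> C. B \<inter> Y = {}} = {B \<in> C. B \<subseteq> range Mid}"
      using BY by (intro Collect_cong conj_cong refl) (simp add: Diff_eq_empty_iff)
    finally show ?thesis
      using card True by (simp add: removed_def C_def)
  next
    case False
    then obtain B u v where B: "B \<in> C" "u \<in> B \<inter> Y" "v \<in> B \<inter> Y" "h u \<noteq> h v"
      using compose by blast
    \<comment> \<open>A compatible extension would be constant on \<open>B\<close>, where the
      prescribed outer colors already differ.\<close>
    have "?G = {}"
    proof (rule ccontr)
      assume "?G \<noteq> {}"
      then obtain g where "compatible C g" "\<forall>y\<in>Y. g y = h y"
        by auto
      then show False
        using B compatibleD[of C g B u v] by auto
    qed
    with card False show ?thesis
      by simp
  qed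
qed

text \<open>Natural-valued, so that the same entries serve for counting with 2 colors and, cast to
  the complex numbers, for the representation.\<close>

definition weight :: "diagram \<Rightarrow> (nat \<Rightarrow> nat) \<Rightarrow> (nat \<Rightarrow> nat) \<Rightarrow> nat" where
  "weight d t b = of_bool (compatible d (case_sum t b))"

lemma finite_colorings: "finite (colorings N m)"
  by (simp add: finite_PiE)

text \<open>Composition is matrix multiplication up to a power of the number of colors, the same
  power as in the algebra product when \<open>N\<close> is the parameter.\<close>

lemma sum_weight_weight:
  assumes "partition_on (vertices m) d1" "partition_on (vertices m) d2"
    and "t \<in> colorings N m" "b \<in> colorings N m"
  shows "(\<Sum>c\<in>colorings N m. weight d1 t c * weight d2 c b) =
    N ^ removed d1 d2 * weight (compose_diagrams d1 d2) t b"
proof -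
  have "(\<Sum>c\<in>colorings N m. weight d1 t c * weight d2 c b) =
      (\<Sum>c\<in>colorings N m. of_bool (compatible d1 (case_sum t c) \<and> compatible d2 (case_sum c b)))"
    by (simp add: weight_def of_bool_conj)
  also have "\<dots> = card {c \<in> colorings N m. compatible d1 (case_sum t c) \<and> compatible d2 (case_sum c b)}"
    using finite_colorings by (subst sum_of_bool_eq) (auto simp: Int_def)
  finally show ?thesis
    using card_middle_colorings[OF assms] by (simp add: weight_def)
qed

lemma compatible_restrict:
  assumes "partition_on (vertices m) d"
  shows "compatible d (case_sum (\<lambda>i\<in>{1..m}. g (Inl i)) (\<lambda>i\<in>{1..m}. g (Inr i))) \<longleftrightarrow> compatible d g"
  using assms by (rule compatible_cong) (auto simp: vertices_def)

lemma same_block_iff_colorings: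
  assumes d: "partition_on (vertices m) d" and uv: "u \<in> vertices m" "v \<in> vertices m"
  shows "(u, v) \<in> same_block d \<longleftrightarrow> (\<forall>t\<in>colorings 2 m. \<forall>b\<in>colorings 2 m.
    compatible d (case_sum t b) \<longrightarrow> case_sum t b u = case_sum t b v)"
proof
  assume *: "\<forall>t\<in>colorings 2 m. \<forall>b\<in>colorings 2 m.
    compatible d (case_sum t b) \<longrightarrow> case_sum t b u = case_sum t b v"
  have "g u = g v" if g: "range g \<subseteq> {..<2::nat}" "compatible d g" for g
  proof -
    define t where "t = (\<lambda>i\<in>{1..m}. g (Inl i))"
    define b where "b = (\<lambda>i\<in>{1..m}. g (Inr i))"
    have "t \<in> colorings 2 m" "b \<in> colorings 2 m"
      using g(1) by (auto simp: t_def b_def)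
    moreover have "compatible d (case_sum t b)"
      using compatible_restrict[OF d] g(2) unfolding t_def b_def by blast
    ultimately have "case_sum t b u = case_sum t b v"
      using * by blast
    with uv show ?thesis
      by (auto simp: t_def b_def vertices_def)
  qed
  then show "(u, v) \<in> same_block d"
    using same_block_iff_compatible[OF d uv] by blast
qed (unfold compatible_def, blast)

text \<open>Two colors separate partitions. The exponents can be compared because the constant
  coloring is compatible with every diagram, so its entry is never 0.\<close>

lemma diagram_eqI:
  assumes d: "partition_on (vertices m) d" and e: "partition_on (vertices m) e"
    and *: "\<And>t b. \<lbrakk>t \<in> colorings 2 m; b \<in> colorings 2 m\<rbrakk> \<Longrightarrow> 2 ^ r * weight d t b = 2 ^ s * weight e t b"
  shows "d = e" and "r = s"
proof -
  have compat: "compatible d (case_sum t b) \<longleftrightarrow> compatible e (case_sum t b)"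
    if "t \<in> colorings 2 m" "b \<in> colorings 2 m" for t b
    using *[OF that] by (simp add: weight_def of_bool_def split: if_splits)
  have "(u, v) \<in> same_block d \<longleftrightarrow> (u, v) \<in> same_block e" if "u \<in> vertices m" "v \<in> vertices m" for u v
    unfolding same_block_iff_colorings[OF d that] same_block_iff_colorings[OF e that]
    using compat by (metis (no_types, lifting))
  moreover have "same_block d \<subseteq> vertices m \<times> vertices m" "same_block e \<subseteq> vertices m \<times> vertices m"
    using equiv_same_block[OF d] equiv_same_block[OF e] by (auto simp: equiv_def)
  ultimately have "same_block d = same_block e"
    by (intro subset_antisym subrelI) blast+
  then show "d = e"
    using partition_on_eqI[OF d e] by blast
  define z :: "nat \<Rightarrow> nat" where "z = (\<lambda>i\<in>{1..m}. 0)"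
  have z: "z \<in> colorings 2 m"
    by (simp add: z_def)
  have "compatible d (case_sum z z)"
    using compatible_restrict[OF d, of "\<lambda>_. 0"] by (simp add: compatible_def z_def)
  with *[OF z z] \<open>d = e\<close> show "r = s"
    by (simp add: weight_def)
qed

text \<open>Both sides are the product of the same three matrices over 2 colors;
  \<open>diagram_eqI\<close> yields the diagrams and the exponents together.\<close>

lemma compose_assoc:
  assumes d: "partition_on (vertices m) d1" "partition_on (vertices m) d2" "partition_on (vertices m) d3"
  shows "compose_diagrams (compose_diagrams d1 d2) d3 = compose_diagrams d1 (compose_diagrams d2 d3)"
    and "removed d1 d2 + removed (compose_diagrams d1 d2) d3 =
      removed d2 d3 + removed d1 (compose_diagrams d2 d3)"
proof -
  note part = partition_on_compose[OF d(1,2)] partition_on_compose[OF d(2,3)]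
  have "2 ^ (removed d1 d2 + removed (compose_diagrams d1 d2) d3) *
      weight (compose_diagrams (compose_diagrams d1 d2) d3) t b =
    2 ^ (removed d2 d3 + removed d1 (compose_diagrams d2 d3)) *
      weight (compose_diagrams d1 (compose_diagrams d2 d3)) t b"
    if tb: "t \<in> colorings 2 m" "b \<in> colorings 2 m" for t b
  proof -
    let ?S = "colorings 2 m"
    have "2 ^ (removed d1 d2 + removed (compose_diagrams d1 d2) d3) *
        weight (compose_diagrams (compose_diagrams d1 d2) d3) t b =
      (\<Sum>e\<in>?S. 2 ^ removed d1 d2 * weight (compose_diagrams d1 d2) t e * weight d3 e b)"
      using sum_weight_weight[OF part(1) d(3) tb]
      by (simp only: power_add mult.assoc sum_distrib_left[symmetric])
    also have "\<dots> = (\<Sum>e\<in>?S. (\<Sum>c\<in>?S. weight d1 t c * weight d2 c e) * weight d3 e b)"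
      using sum_weight_weight[OF d(1,2) tb(1)] by simp
    also have "\<dots> = (\<Sum>c\<in>?S. weight d1 t c * (\<Sum>e\<in>?S. weight d2 c e * weight d3 e b))"
      unfolding sum_distrib_left sum_distrib_right mult.assoc by (rule sum.swap)
    also have "\<dots> = (\<Sum>c\<in>?S. weight d1 t c * (2 ^ removed d2 d3 * weight (compose_diagrams d2 d3) c b))"
      using sum_weight_weight[OF d(2,3) _ tb(2)] by simp
    also have "\<dots> = 2 ^ (removed d2 d3 + removed d1 (compose_diagrams d2 d3)) *
        weight (compose_diagrams d1 (compose_diagrams d2 d3)) t b"
      unfolding mult.left_commute[of _ "2 ^ removed d2 d3"] sum_distrib_left[symmetric]
        sum_weight_weight[OF d(1) part(2) tb] by (simp only: power_add mult.assoc)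
    finally show ?thesis .
  qed
  from diagram_eqI[OF partition_on_compose[OF part(1) d(3)] partition_on_compose[OF d(1) part(2)] this]
  show "compose_diagrams (compose_diagrams d1 d2) d3 = compose_diagrams d1 (compose_diagrams d2 d3)"
    and "removed d1 d2 + removed (compose_diagrams d1 d2) d3 =
      removed d2 d3 + removed d1 (compose_diagrams d2 d3)"
    by blast+
qed

lemma partition_on_id_diagram: "partition_on (vertices m) (id_diagram m)"
  by (rule partition_onI) (auto simp: vertices_def id_diagram_def disjnt_def)

lemma weight_id_diagram:
  assumes "t \<in> colorings N m" "b \<in> colorings N m"
  shows "weight (id_diagram m) t b = of_bool (t = b)"
proof -
  have "compatible (id_diagram m) (case_sum t b) \<longleftrightarrow> (\<forall>i\<in>{1..m}. t i = b i)"
    unfolding compatible_iff id_diagram_def by auto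
  also have "\<dots> \<longleftrightarrow> t = b"
    using assms PiE_ext[of t "{1..m}" "\<lambda>_. {..<N}" b] by auto
  finally show ?thesis
    by (simp add: weight_def)
qed

lemma compose_id_diagram:
  assumes d: "partition_on (vertices m) d"
  shows "compose_diagrams d (id_diagram m) = d" and "removed d (id_diagram m) = 0"
proof -
  have "2 ^ removed d (id_diagram m) * weight (compose_diagrams d (id_diagram m)) t b = 2 ^ 0 * weight d t b"
    if tb: "t \<in> colorings 2 m" "b \<in> colorings 2 m" for t b
  proof -
    have "(\<Sum>c\<in>colorings 2 m. weight d t c * weight (id_diagram m) c b) =
        (\<Sum>c\<in>colorings 2 m. if c = b then weight d t c else 0)"
      by (intro sum.cong refl) (simp add: weight_id_diagram[OF _ tb(2)])
    also have "\<dots> = weight d t b"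
      using tb(2) by (simp add: sum.delta finite_PiE)
    finally show ?thesis
      using sum_weight_weight[OF d partition_on_id_diagram tb] by simp
  qed
  from diagram_eqI[OF partition_on_compose[OF d partition_on_id_diagram] d this]
  show "compose_diagrams d (id_diagram m) = d" "removed d (id_diagram m) = 0"
    by blast+
qed

section \<open>Reflection of diagrams, which transposes their matrices\<close>

definition flip :: "diagram \<Rightarrow> diagram" where
  "flip d = (`) (case_sum Inr Inl) ` d"

lemma flip_flip [simp]: "flip (flip d) = d"
proof -
  have "case_sum Inr Inl (case_sum Inr Inl v) = v" for v :: "nat + nat"
    by (cases v) auto
  then show ?thesis
    by (simp add: flip_def image_image)
qed

lemma partition_on_flip:
  assumes "partition_on (vertices m) d"
  shows "partition_on (vertices m) (flip d)"
proof -
  have "case_sum Inr Inl ` vertices m = vertices m"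
    by (auto simp: vertices_def image_Un image_image)
  moreover have "inj_on (case_sum Inr Inl) (vertices m)"
    by (auto simp: inj_on_def split: sum.splits)
  moreover have "flip d = (`) (case_sum Inr Inl) ` d - {{}}"
    using partition_onD3[OF assms] by (auto simp: flip_def)
  ultimately show ?thesis
    using partition_on_inj_image[OF assms, of "case_sum Inr Inl"] by simp
qed

lemma weight_flip [simp]: "weight (flip d) t b = weight d b t"
proof -
  have "case_sum t b (case_sum Inr Inl v) = case_sum b t v" for v
    by (cases v) auto
  then show ?thesis
    by (simp add: weight_def compatible_iff flip_def)
qed

lemma flip_compose:
  assumes d: "partition_on (vertices m) d1" "partition_on (vertices m) d2"
  shows "flip (compose_diagrams d1 d2) = compose_diagrams (flip d2) (flip d1)"
    and "removed d1 d2 = removed (flip d2) (flip d1)"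
proof -
  have "2 ^ removed d1 d2 * weight (flip (compose_diagrams d1 d2)) t b =
      2 ^ removed (flip d2) (flip d1) * weight (compose_diagrams (flip d2) (flip d1)) t b"
    if tb: "t \<in> colorings 2 m" "b \<in> colorings 2 m" for t b
    using sum_weight_weight[OF d tb(2,1)]
      sum_weight_weight[OF partition_on_flip[OF d(2)] partition_on_flip[OF d(1)] tb]
    by (simp add: mult.commute)
  from diagram_eqI[OF partition_on_flip[OF partition_on_compose[OF d]]
      partition_on_compose[OF partition_on_flip[OF d(2)] partition_on_flip[OF d(1)]] this]
  show "flip (compose_diagrams d1 d2) = compose_diagrams (flip d2) (flip d1)"
    and "removed d1 d2 = removed (flip d2) (flip d1)"
    by blast+
qed

text \<open>Qualitative form of \<open>card_middle_colorings\<close>, where \<open>N > 0\<close>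
  keeps the power of \<open>N\<close> from vanishing. It turns questions about the blocks of a
  composition into the extension of colorings to the middle row.\<close>

lemma compatible_compose_iff:
  assumes d: "partition_on (vertices m) d1" "partition_on (vertices m) d2"
    and tb: "t \<in> colorings N m" "b \<in> colorings N m" and N: "N > 0"
  shows "compatible (compose_diagrams d1 d2) (case_sum t b) \<longleftrightarrow>
    (\<exists>c\<in>colorings N m. compatible d1 (case_sum t c) \<and> compatible d2 (case_sum c b))"
proof -
  have "compatible (compose_diagrams d1 d2) (case_sum t b) \<longleftrightarrow>
    card {c \<in> colorings N m. compatible d1 (case_sum t c) \<and> compatible d2 (case_sum c b)} \<noteq> 0"
    using card_middle_colorings[OF d tb] N by simp
  also have "\<dots> \<longleftrightarrow> (\<exists>c\<in>colorings N m. compatible d1 (case_sum t c) \<and> compatible d2 (case_sum c b))"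
    using finite_colorings by (subst card_eq_0_iff) auto
  finally show ?thesis .
qed

section \<open>The representation by colorings\<close>

locale half_integer =
  fixes k :: rat
  assumes half_integer: "2 * k \<in> \<nat>"
begin

definition cols :: nat where
  "cols = columns k"

definition joined :: bool where
  "joined \<longleftrightarrow> k \<notin> \<nat>"

abbreviation "verts \<equiv> vertices cols"

text \<open>Treats both kinds of \<open>k\<close> at once: gluing the last column costs one block,
  so \<open>2 * k\<close> is the largest number of blocks of a diagram.\<close>

lemma two_k: "2 * k = of_nat (2 * cols) - of_bool joined"
proof (cases "k \<in> \<nat>")
  case True
  then show ?thesis
    by (auto simp: cols_def joined_def columns_def Nats_def)
next
  case False
  obtain a where a: "2 * k = of_nat a"
    using half_integer by (auto simp: Nats_def)
  have "odd a"
  proof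
    assume "even a"
    then obtain b where "a = 2 * b" by auto
    with a have "k = of_nat b" by simp
    with False show False by simp
  qed
  then obtain b where b: "a = 2 * b + 1"
    by (elim oddE)
  then have k: "k = of_nat b + 1 / 2"
    using a by simp
  have "\<lceil>k\<rceil> = int b + 1"
    unfolding k by (rule ceiling_unique) simp_all
  then have "cols = b + 1"
    unfolding cols_def columns_def by simp
  with False show ?thesis
    using a b by (simp add: joined_def)
qed

lemma cols_pos: "joined \<Longrightarrow> cols \<ge> 1"
  using two_k half_integer by (cases cols) (auto simp: Nats_def)

lemma in_diagrams_iff:
  "d \<in> diagrams k \<longleftrightarrow> partition_on verts d \<and> (joined \<longrightarrow> (Inl cols, Inr cols) \<in> same_block d)"
  by (auto simp: diagrams_def cols_def joined_def same_block_def)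

lemma partition_on_diagram: "d \<in> diagrams k \<Longrightarrow> partition_on verts d"
  by (simp add: in_diagrams_iff)

lemma finite_vertices: "finite verts"
  by (simp add: vertices_def)

lemma finite_diagrams: "finite (diagrams k)"
  using finitely_many_partition_on[OF finite_vertices] by (auto simp: in_diagrams_iff intro: finite_subset[rotated])

text \<open>The last column stays joined because a compatible coloring passes its color from the top
  through the middle to the bottom vertex.\<close>

lemma compose_in_diagrams:
  assumes "d1 \<in> diagrams k" "d2 \<in> diagrams k"
  shows "compose_diagrams d1 d2 \<in> diagrams k"
proof -
  note d = assms[THEN partition_on_diagram]
  have "(Inl cols, Inr cols) \<in> same_block (compose_diagrams d1 d2)" if joined
  proof -
    have "Inl cols \<in> verts" "Inr cols \<in> verts"
      using cols_pos[OF that] by (auto simp: vertices_def)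
    moreover have "t cols = b cols"
      if tb: "t \<in> colorings 2 cols" "b \<in> colorings 2 cols"
        and compat: "compatible (compose_diagrams d1 d2) (case_sum t b)" for t b
    proof -
      obtain c where c: "compatible d1 (case_sum t c)" "compatible d2 (case_sum c b)"
        using compatible_compose_iff[OF d tb] compat by auto
      have "(Inl cols, Inr cols) \<in> same_block d1" "(Inl cols, Inr cols) \<in> same_block d2"
        using assms \<open>joined\<close> by (auto simp: in_diagrams_iff)
      then show ?thesis
        using c unfolding compatible_def by fastforce
    qed
    ultimately show ?thesis
      using same_block_iff_colorings[OF partition_on_compose[OF d]] by simp
  qed
  then show ?thesis
    using partition_on_compose[OF d] by (simp add: in_diagrams_iff)
qed

lemma id_in_diagrams: "id_diagram cols \<in> diagrams k"
  using cols_pos partition_on_id_diagram by (auto simp: in_diagrams_iff same_block_def id_diagram_def)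

lemma flip_in_diagrams:
  assumes "d \<in> diagrams k"
  shows "flip d \<in> diagrams k"
proof -
  have "(Inl cols, Inr cols) \<in> same_block (flip d)" if joined
  proof -
    obtain B where B: "B \<in> d" "Inl cols \<in> B" "Inr cols \<in> B"
      using assms \<open>joined\<close> by (auto simp: in_diagrams_iff same_block_def)
    then have "case_sum Inr Inl ` B \<in> flip d"
      by (simp add: flip_def)
    moreover have "Inl cols \<in> case_sum Inr Inl ` B" "Inr cols \<in> case_sum Inr Inl ` B"
      using imageI[OF B(2), of "case_sum Inr Inl"] imageI[OF B(3), of "case_sum Inr Inl"] by simp_all
    ultimately show ?thesis
      unfolding same_block_def by blast
  qed
  then show ?thesis
    using assms partition_on_flip by (simp add: in_diagrams_iff)
qed

end

locale partition_alg = half_integer +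
  fixes x :: complex
begin

abbreviation "PA \<equiv> partition_algebra k x"

lemma mult_eq: "(f \<otimes>\<^bsub>PA\<^esub> g) e = (\<Sum>d1\<in>diagrams k. \<Sum>d2\<in>diagrams k.
    if compose_diagrams d1 d2 = e then f d1 * g d2 * x ^ removed d1 d2 else 0)"
  by (simp add: partition_algebra_def)

text \<open>Evaluates at a product the linear functional with values \<open>w\<close> on diagrams.
  Its instances are matrix entries, \<open>perm_sum\<close> and, in the associativity proof, the
  coefficients after one more multiplication.\<close>

lemma sum_mult:
  "(\<Sum>d\<in>diagrams k. (f \<otimes>\<^bsub>PA\<^esub> g) d * w d) = (\<Sum>d1\<in>diagrams k. \<Sum>d2\<in>diagrams k.
     f d1 * g d2 * x ^ removed d1 d2 * w (compose_diagrams d1 d2))"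
proof -
  have "(\<Sum>d\<in>diagrams k. (f \<otimes>\<^bsub>PA\<^esub> g) d * w d) = (\<Sum>d1\<in>diagrams k. \<Sum>d2\<in>diagrams k. \<Sum>d\<in>diagrams k.
      (if compose_diagrams d1 d2 = d then f d1 * g d2 * x ^ removed d1 d2 else 0) * w d)"
    unfolding mult_eq sum_distrib_right by (rule trans[OF sum.swap], intro sum.cong refl sum.swap)
  also have "\<dots> = (\<Sum>d1\<in>diagrams k. \<Sum>d2\<in>diagrams k.
     f d1 * g d2 * x ^ removed d1 d2 * w (compose_diagrams d1 d2))"
  proof (intro sum.cong refl)
    fix d1 d2 assume d: "d1 \<in> diagrams k" "d2 \<in> diagrams k"
    have "(\<Sum>d\<in>diagrams k. (if compose_diagrams d1 d2 = d then f d1 * g d2 * x ^ removed d1 d2 else 0) * w d) =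
        (\<Sum>d\<in>diagrams k. if compose_diagrams d1 d2 = d
           then f d1 * g d2 * x ^ removed d1 d2 * w (compose_diagrams d1 d2) else 0)"
      by (intro sum.cong refl) simp
    also have "\<dots> = f d1 * g d2 * x ^ removed d1 d2 * w (compose_diagrams d1 d2)"
      using compose_in_diagrams[OF d] finite_diagrams by simp
    finally show "(\<Sum>d\<in>diagrams k. (if compose_diagrams d1 d2 = d then f d1 * g d2 * x ^ removed d1 d2 else 0) * w d) =
      f d1 * g d2 * x ^ removed d1 d2 * w (compose_diagrams d1 d2)" .
  qed
  finally show ?thesis .
qed

lemma mult_assoc_PA: "(f \<otimes>\<^bsub>PA\<^esub> g) \<otimes>\<^bsub>PA\<^esub> h = f \<otimes>\<^bsub>PA\<^esub> (g \<otimes>\<^bsub>PA\<^esub> h)"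
proof
  fix e
  let ?D = "diagrams k"
  have "((f \<otimes>\<^bsub>PA\<^esub> g) \<otimes>\<^bsub>PA\<^esub> h) e = (\<Sum>d\<in>?D. (f \<otimes>\<^bsub>PA\<^esub> g) d *
      (\<Sum>d3\<in>?D. if compose_diagrams d d3 = e then h d3 * x ^ removed d d3 else 0))"
    unfolding mult_eq[of "f \<otimes>\<^bsub>PA\<^esub> g" h] sum_distrib_left by (intro sum.cong refl) simp
  also have "\<dots> = (\<Sum>d1\<in>?D. \<Sum>d2\<in>?D. f d1 * g d2 * x ^ removed d1 d2 *
      (\<Sum>d3\<in>?D. if compose_diagrams (compose_diagrams d1 d2) d3 = e
        then h d3 * x ^ removed (compose_diagrams d1 d2) d3 else 0))"
    by (rule sum_mult)
  also have "\<dots> = (\<Sum>d1\<in>?D. \<Sum>d2\<in>?D. \<Sum>d3\<in>?D. f d1 *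
      (g d2 * h d3 * x ^ removed d2 d3 * (if compose_diagrams d1 (compose_diagrams d2 d3) = e
        then x ^ removed d1 (compose_diagrams d2 d3) else 0)))"
    unfolding sum_distrib_left
  proof (intro sum.cong refl)
    fix d1 d2 d3 assume "d1 \<in> ?D" "d2 \<in> ?D" "d3 \<in> ?D"
    from compose_assoc[OF this[THEN partition_on_diagram]]
    have "compose_diagrams (compose_diagrams d1 d2) d3 = compose_diagrams d1 (compose_diagrams d2 d3)"
      "x ^ removed d1 d2 * x ^ removed (compose_diagrams d1 d2) d3 =
       x ^ removed d2 d3 * x ^ removed d1 (compose_diagrams d2 d3)"
      by (simp_all flip: power_add)
    then show "f d1 * g d2 * x ^ removed d1 d2 * (if compose_diagrams (compose_diagrams d1 d2) d3 = e
        then h d3 * x ^ removed (compose_diagrams d1 d2) d3 else 0) =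
      f d1 * (g d2 * h d3 * x ^ removed d2 d3 * (if compose_diagrams d1 (compose_diagrams d2 d3) = e
        then x ^ removed d1 (compose_diagrams d2 d3) else 0))"
      by (simp add: mult.commute mult.left_commute)
  qed
  also have "\<dots> = (\<Sum>d1\<in>?D. f d1 * (\<Sum>d\<in>?D. (g \<otimes>\<^bsub>PA\<^esub> h) d *
      (if compose_diagrams d1 d = e then x ^ removed d1 d else 0)))"
    unfolding sum_mult sum_distrib_left ..
  also have "\<dots> = (f \<otimes>\<^bsub>PA\<^esub> (g \<otimes>\<^bsub>PA\<^esub> h)) e"
    unfolding mult_eq[of f "g \<otimes>\<^bsub>PA\<^esub> h"] sum_distrib_left by (intro sum.cong refl) simp
  finally show "((f \<otimes>\<^bsub>PA\<^esub> g) \<otimes>\<^bsub>PA\<^esub> h) e = (f \<otimes>\<^bsub>PA\<^esub> (g \<otimes>\<^bsub>PA\<^esub> h)) e" .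
qed

lemma carrier_PA: "carrier PA = {f. \<forall>d. d \<notin> diagrams k \<longrightarrow> f d = 0}"
  by (simp add: partition_algebra_def)

lemma mult_support:
  assumes "(f \<otimes>\<^bsub>PA\<^esub> g) e \<noteq> 0"
  obtains d1 d2 where "d1 \<in> diagrams k" "d2 \<in> diagrams k" "f d1 \<noteq> 0" "g d2 \<noteq> 0" "compose_diagrams d1 d2 = e"
proof -
  obtain d1 where d1: "d1 \<in> diagrams k" and sum: "(\<Sum>d2\<in>diagrams k. if compose_diagrams d1 d2 = e then f d1 * g d2 * x ^ removed d1 d2 else 0) \<noteq> 0"
    using assms unfolding mult_eq by (rule sum.not_neutral_contains_not_neutral)
  from sum obtain d2 where "d2 \<in> diagrams k"
      "(if compose_diagrams d1 d2 = e then f d1 * g d2 * x ^ removed d1 d2 else 0) \<noteq> 0"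
    by (rule sum.not_neutral_contains_not_neutral)
  with d1 show thesis
    by (intro that[of d1 d2]) (auto split: if_splits)
qed

lemma mult_one_PA:
  assumes "f \<in> carrier PA"
  shows "f \<otimes>\<^bsub>PA\<^esub> \<one>\<^bsub>PA\<^esub> = f"
proof
  fix e
  have "(f \<otimes>\<^bsub>PA\<^esub> \<one>\<^bsub>PA\<^esub>) e = (\<Sum>d1\<in>diagrams k. if d1 = e then f d1 else 0)"
    unfolding mult_eq
  proof (intro sum.cong refl)
    fix d1 assume d1: "d1 \<in> diagrams k"
    have "(\<Sum>d2\<in>diagrams k. if compose_diagrams d1 d2 = e then f d1 * \<one>\<^bsub>PA\<^esub> d2 * x ^ removed d1 d2 else 0) =
        (\<Sum>d2\<in>diagrams k. if d2 = id_diagram cols then if d1 = e then f d1 else 0 else 0)"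
      using compose_id_diagram[OF partition_on_diagram[OF d1]]
      by (intro sum.cong refl) (auto simp: partition_algebra_def cols_def)
    then show "(\<Sum>d2\<in>diagrams k. if compose_diagrams d1 d2 = e then f d1 * \<one>\<^bsub>PA\<^esub> d2 * x ^ removed d1 d2 else 0) =
        (if d1 = e then f d1 else 0)"
      using finite_diagrams id_in_diagrams by simp
  qed
  then show "(f \<otimes>\<^bsub>PA\<^esub> \<one>\<^bsub>PA\<^esub>) e = f e"
    using assms finite_diagrams by (simp add: carrier_PA)
qed

sublocale function_algebra PA "diagrams k"
proof
  fix f g h :: "diagram \<Rightarrow> complex" and c :: complex
  show "f \<otimes>\<^bsub>PA\<^esub> g \<in> carrier PA"
    unfolding carrier_PA using mult_support compose_in_diagrams by (auto, metis)
  show "f \<otimes>\<^bsub>PA\<^esub> (g + h) = f \<otimes>\<^bsub>PA\<^esub> g + f \<otimes>\<^bsub>PA\<^esub> h"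
  proof
    fix e
    show "(f \<otimes>\<^bsub>PA\<^esub> (g + h)) e = (f \<otimes>\<^bsub>PA\<^esub> g + f \<otimes>\<^bsub>PA\<^esub> h) e"
      unfolding plus_fun_apply mult_eq sum.distrib[symmetric]
      by (intro sum.cong refl) (simp add: algebra_simps)
  qed
  show "f \<otimes>\<^bsub>PA\<^esub> scale_fun c g = scale_fun c (f \<otimes>\<^bsub>PA\<^esub> g)"
  proof
    fix e
    show "(f \<otimes>\<^bsub>PA\<^esub> scale_fun c g) e = scale_fun c (f \<otimes>\<^bsub>PA\<^esub> g) e"
      unfolding scale_fun_apply mult_eq sum_distrib_left
      by (intro sum.cong refl) simp
  qed
  show "0 \<otimes>\<^bsub>PA\<^esub> f = 0"
  proof
    fix e
    show "(0 \<otimes>\<^bsub>PA\<^esub> f) e = 0 e"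
      unfolding mult_eq zero_fun_apply by (intro sum.neutral ballI) simp
  qed
  show "\<one>\<^bsub>PA\<^esub> \<in> carrier PA"
    using id_in_diagrams by (auto simp: partition_algebra_def cols_def)
qed (simp_all add: finite_diagrams carrier_PA mult_assoc_PA mult_one_PA,
     simp_all add: partition_algebra_def fun_eq_iff)

end

locale integer_partition_alg = half_integer +
  fixes n :: nat
begin

sublocale partition_alg k "of_nat n" ..

abbreviation "cs \<equiv> colorings n cols"

text \<open>The representation on the tensor power of an \<open>n\<close>-dimensional space, as a matrix whose rows
  and columns are indexed by colorings.\<close>

definition mat :: "(diagram \<Rightarrow> complex) \<Rightarrow> (nat \<Rightarrow> nat) \<Rightarrow> (nat \<Rightarrow> nat) \<Rightarrow> complex" where
  "mat f t b = (\<Sum>d\<in>diagrams k. f d * of_nat (weight d t b))"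

lemma mat_add: "mat (f + g) t b = mat f t b + mat g t b"
  by (simp add: mat_def algebra_simps sum.distrib)

lemma mat_scale: "mat (scale_fun c f) t b = c * mat f t b"
  by (simp add: mat_def sum_distrib_left mult.assoc)

lemma mat_mult:
  assumes tb: "t \<in> cs" "b \<in> cs"
  shows "mat (f \<otimes>\<^bsub>PA\<^esub> g) t b = (\<Sum>c\<in>cs. mat f t c * mat g c b)"
proof -
  let ?D = "diagrams k"
  have "mat (f \<otimes>\<^bsub>PA\<^esub> g) t b = (\<Sum>d1\<in>?D. \<Sum>d2\<in>?D.
     f d1 * g d2 * of_nat n ^ removed d1 d2 * of_nat (weight (compose_diagrams d1 d2) t b))"
    unfolding mat_def by (rule sum_mult)
  also have "\<dots> = (\<Sum>d1\<in>?D. \<Sum>d2\<in>?D. \<Sum>c\<in>cs. f d1 * of_nat (weight d1 t c) * (g d2 * of_nat (weight d2 c b)))"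
  proof (intro sum.cong refl)
    fix d1 d2 assume "d1 \<in> ?D" "d2 \<in> ?D"
    from sum_weight_weight[OF this[THEN partition_on_diagram] tb]
    have "of_nat n ^ removed d1 d2 * of_nat (weight (compose_diagrams d1 d2) t b) =
        (\<Sum>c\<in>cs. of_nat (weight d1 t c) * of_nat (weight d2 c b) :: complex)"
      by (metis (mono_tags, lifting) of_nat_mult of_nat_power of_nat_sum sum.cong)
    then have "f d1 * g d2 * of_nat n ^ removed d1 d2 * of_nat (weight (compose_diagrams d1 d2) t b) =
      f d1 * g d2 * (\<Sum>c\<in>cs. of_nat (weight d1 t c) * of_nat (weight d2 c b))"
      by (simp only: mult.assoc)
    also have "\<dots> = (\<Sum>c\<in>cs. f d1 * of_nat (weight d1 t c) * (g d2 * of_nat (weight d2 c b)))"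
      unfolding sum_distrib_left by (intro sum.cong refl) (simp only: mult_ac)
    finally show "f d1 * g d2 * of_nat n ^ removed d1 d2 * of_nat (weight (compose_diagrams d1 d2) t b) =
      (\<Sum>c\<in>cs. f d1 * of_nat (weight d1 t c) * (g d2 * of_nat (weight d2 c b)))" .
  qed
  also have "\<dots> = (\<Sum>d1\<in>?D. \<Sum>c\<in>cs. \<Sum>d2\<in>?D. f d1 * of_nat (weight d1 t c) * (g d2 * of_nat (weight d2 c b)))"
    by (intro sum.cong refl sum.swap)
  also have "\<dots> = (\<Sum>c\<in>cs. \<Sum>d1\<in>?D. \<Sum>d2\<in>?D. f d1 * of_nat (weight d1 t c) * (g d2 * of_nat (weight d2 c b)))"
    by (rule sum.swap)
  finally show ?thesis
    unfolding mat_def sum_product .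
qed

end

section \<open>Sums over refinements\<close>

text \<open>A triangular system. The unknown of an \<open>s\<close> with maximal \<open>r s\<close>
  occurs in no other equation, so the others are solved first and \<open>y s\<close> then settles
  the equation at \<open>s\<close>. Injectivity of \<open>r\<close> keeps two indices from sharing a
  set.\<close>

lemma zeta_solvable:
  fixes r :: "'a \<Rightarrow> 'b set" and g :: "'a \<Rightarrow> 'c::ab_group_add"
  assumes "finite S" "inj_on r S"
  shows "\<exists>y. (\<forall>s. s \<notin> S \<longrightarrow> y s = 0) \<and> (\<forall>s\<in>S. (\<Sum>t\<in>{t \<in> S. r t \<subseteq> r s}. y t) = g s)"
  using assms
proof (induction S rule: finite_psubset_induct)
  case (psubset S)
  show ?case
  proof (cases "S = {}")
    case False
    then obtain m where m: "m \<in> r ` S" "\<And>a. \<lbrakk>a \<in> r ` S; m \<subseteq> a\<rbrakk> \<Longrightarrow> m = a"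
      using finite_has_maximal[of "r ` S"] psubset.hyps by auto
    then obtain s where s: "s \<in> S" "m = r s"
      by auto
    have max: "\<not> r s \<subseteq> r t" if "t \<in> S" "t \<noteq> s" for t
      using m(2)[of "r t"] that s psubset.prems by (auto simp: inj_on_eq_iff)
    define S' where "S' = S - {s}"
    have "S' \<subset> S" "inj_on r S'"
      using s psubset.prems by (auto simp: S'_def intro: inj_on_subset)
    then obtain y where y: "\<And>t. t \<notin> S' \<Longrightarrow> y t = 0"
        "\<And>t. t \<in> S' \<Longrightarrow> (\<Sum>u\<in>{u \<in> S'. r u \<subseteq> r t}. y u) = g t"
      using psubset.IH[of S'] by auto
    define z where "z = y(s := g s - (\<Sum>u\<in>{u \<in> S'. r u \<subseteq> r s}. y u))"
    have z_sum: "(\<Sum>u\<in>{u \<in> S'. r u \<subseteq> r t}. z u) = (\<Sum>u\<in>{u \<in> S'. r u \<subseteq> r t}. y u)" for t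
      by (intro sum.cong refl) (auto simp: z_def S'_def)
    have "(\<Sum>u\<in>{u \<in> S. r u \<subseteq> r t}. z u) = g t" if t: "t \<in> S" for t
    proof (cases "t = s")
      case True
      have "{u \<in> S. r u \<subseteq> r s} = insert s {u \<in> S'. r u \<subseteq> r s}"
        using s(1) by (auto simp: S'_def)
      moreover have "finite {u \<in> S'. r u \<subseteq> r s}" "s \<notin> {u \<in> S'. r u \<subseteq> r s}"
        using psubset.hyps by (auto simp: S'_def)
      ultimately show ?thesis
        using True z_sum[of s] by (simp add: z_def)
    next
      case False
      then have "{u \<in> S. r u \<subseteq> r t} = {u \<in> S'. r u \<subseteq> r t}"
        using max[OF t] by (auto simp: S'_def)
      then show ?thesis
        using z_sum[of t] y(2)[of t] t False by (simp add: S'_def)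
    qed
    moreover have "z t = 0" if "t \<notin> S" for t
      using that y(1)[of t] s(1) by (auto simp: z_def S'_def)
    ultimately show ?thesis
      by blast
  qed auto
qed

text \<open>Uniqueness for the same triangular system, from the smallest sets upwards; finiteness of
  the sets lets cardinality drive the induction.\<close>

lemma zeta_injective:
  fixes r :: "'a \<Rightarrow> 'b set" and f :: "'a \<Rightarrow> 'c::ab_group_add"
  assumes "finite S" "inj_on r S" "\<And>s. s \<in> S \<Longrightarrow> finite (r s)"
    and sum: "\<And>s. s \<in> S \<Longrightarrow> (\<Sum>t\<in>{t \<in> S. r t \<subseteq> r s}. f t) = 0"
  shows "s \<in> S \<Longrightarrow> f s = 0"
proof (induction "card (r s)" arbitrary: s rule: less_induct)
  case less
  have "f t = 0" if t: "t \<in> S" "r t \<subseteq> r s" "t \<noteq> s" for t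
  proof -
    have "r t \<noteq> r s"
      using assms(2) t less.prems by (auto simp: inj_on_eq_iff)
    then have "card (r t) < card (r s)"
      using t(2) assms(3)[OF less.prems] by (intro psubset_card_mono) auto
    then show ?thesis
      using less.hyps t(1) by blast
  qed
  then have "(\<Sum>t\<in>{t \<in> S. r t \<subseteq> r s}. f t) = (\<Sum>t\<in>{s}. f t)"
    using assms(1) less.prems by (intro sum.mono_neutral_right) auto
  with sum[OF less.prems] show ?case
    by simp
qed

section \<open>Singleton blocks under composition\<close>

lemma singleton_block_eq: "\<lbrakk>partition_on A P; {w} \<in> P; B \<in> P; w \<in> B\<rbrakk> \<Longrightarrow> B = {w}"
  using same_block_image_eq[of A P B w] same_block_image_eq[of A P "{w}" w] by simp

lemma singleton_block_iff:
  assumes P: "partition_on A P" and w: "w \<in> A"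
  shows "{w} \<in> P \<longleftrightarrow> (\<forall>u. (w, u) \<in> same_block P \<longrightarrow> u = w)"
proof
  assume "{w} \<in> P"
  then show "\<forall>u. (w, u) \<in> same_block P \<longrightarrow> u = w"
    using same_block_image_eq[OF P] by blast
next
  assume *: "\<forall>u. (w, u) \<in> same_block P \<longrightarrow> u = w"
  obtain B where B: "B \<in> P" "w \<in> B"
    using P w by (auto simp: partition_on_def)
  then have "B = {w}"
    using * by (auto simp: same_block_def)
  with B show "{w} \<in> P"
    by simp
qed

text \<open>Giving color 1 to \<open>Inl i\<close> alone is compatible with \<open>d1\<close>, and
  color 0 continues through the middle row to the bottom. So some compatible coloring of the
  composition separates \<open>Inl i\<close> from all other vertices.\<close>

lemma singleton_block_compose_left:
  assumes d: "partition_on (vertices m) d1" "partition_on (vertices m) d2"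
    and i: "i \<in> {1..m}" "{Inl i} \<in> d1"
  shows "{Inl i} \<in> compose_diagrams d1 d2"
proof -
  have iV: "Inl i \<in> vertices m"
    using i by (auto simp: vertices_def)
  define z :: "nat \<Rightarrow> nat" where "z = (\<lambda>j\<in>{1..m}. 0)"
  define t :: "nat \<Rightarrow> nat" where "t = (\<lambda>j\<in>{1..m}. if j = i then 1 else 0)"
  have col: "t \<in> colorings 2 m" "z \<in> colorings 2 m"
    by (auto simp: t_def z_def)
  have "compatible d1 (case_sum t z)"
  proof -
    have "compatible d1 (\<lambda>v. if v = Inl i then 1 else 0 :: nat)"
      unfolding compatible_iff using singleton_block_eq[OF d(1) i(2)] by (metis singletonD)
    from iffD2[OF compatible_restrict[OF d(1)] this] show ?thesis
      by (simp add: t_def z_def)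
  qed
  moreover have "compatible d2 (case_sum z z)"
    using compatible_restrict[OF d(2), of "\<lambda>_. 0 :: nat"] by (simp add: compatible_def z_def)
  ultimately have compat: "compatible (compose_diagrams d1 d2) (case_sum t z)"
    unfolding compatible_compose_iff[OF d col zero_less_numeral] by (intro bexI[of _ z] conjI col(2))
  have "u = Inl i" if "(Inl i, u) \<in> same_block (compose_diagrams d1 d2)" for u
  proof -
    have "u \<in> vertices m"
      using that equiv_same_block[OF partition_on_compose[OF d]] by (auto simp: equiv_def)
    moreover have "case_sum t z (Inl i) = case_sum t z u"
      using compat that unfolding compatible_def by blast
    then have "case_sum t z u \<noteq> 0"
      using i(1) by (simp add: t_def)
    moreover have "case_sum t z v = 0" if "v \<in> vertices m" "v \<noteq> Inl i" for v
      using that by (auto simp: vertices_def t_def z_def split: if_splits)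
    ultimately show ?thesis
      by metis
  qed
  then show ?thesis
    using singleton_block_iff[OF partition_on_compose[OF d] iV] by blast
qed

lemma singleton_block_flip: "{Inl i} \<in> flip d \<longleftrightarrow> {Inr i} \<in> d" "{Inr i} \<in> flip d \<longleftrightarrow> {Inl i} \<in> d"
proof -
  have "case_sum Inr Inl ` {Inr i} \<in> flip d" if "{Inr i} \<in> d" for d :: diagram and i
    using that unfolding flip_def by (rule imageI)
  moreover have "case_sum Inr Inl ` {Inl i} \<in> flip d" if "{Inl i} \<in> d" for d :: diagram and i
    using that unfolding flip_def by (rule imageI)
  ultimately show "{Inl i} \<in> flip d \<longleftrightarrow> {Inr i} \<in> d" "{Inr i} \<in> flip d \<longleftrightarrow> {Inl i} \<in> d"
    using flip_flip[of d] by (metis image_empty image_insert sum.case(1,2))+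
qed

lemma singleton_block_compose_right:
  assumes d: "partition_on (vertices m) d1" "partition_on (vertices m) d2"
    and i: "i \<in> {1..m}" "{Inr i} \<in> d2"
  shows "{Inr i} \<in> compose_diagrams d1 d2"
  using singleton_block_compose_left[OF partition_on_flip[OF d(2)] partition_on_flip[OF d(1)] i(1)] i(2)
  by (simp add: singleton_block_flip flip: flip_compose[OF d])

context half_integer
begin

text \<open>For the bottom vertices of \<open>J\<close> these diagrams are unchanged by placing
  \<open>split_diagram J\<close> below them; for both rows of \<open>J\<close> they support the
  two-sided products with it; for the empty set they are all diagrams.\<close>

definition isolating :: "(nat + nat) set \<Rightarrow> diagram set" where
  "isolating W = {d \<in> diagrams k. \<forall>w\<in>W. {w} \<in> d}"

text \<open>The blocks of the coarsest diagram that isolates \<open>W\<close> and is compatible with \<open>g\<close>.\<close>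

definition color_classes :: "(nat + nat) set \<Rightarrow> (nat + nat \<Rightarrow> nat) \<Rightarrow> ((nat + nat) \<times> (nat + nat)) set" where
  "color_classes W g = {(u, v) \<in> verts \<times> verts. u = v \<or> u \<notin> W \<and> v \<notin> W \<and> g u = g v}"

lemma equiv_color_classes: "equiv verts (color_classes W g)"
  by (rule equivI) (auto simp: color_classes_def refl_on_def sym_def trans_def)

lemma isolating_subset: "isolating W \<subseteq> diagrams k"
  by (auto simp: isolating_def)

lemma finite_isolating: "finite (isolating W)"
  using finite_subset[OF isolating_subset finite_diagrams] .

lemma inj_same_block: "inj_on same_block (diagrams k)"
  using partition_on_eqI partition_on_diagram by (auto simp: inj_on_def)

lemma finite_same_block: "d \<in> diagrams k \<Longrightarrow> finite (same_block d)"
  using equiv_same_block[OF partition_on_diagram] finite_vertices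
  by (metis equiv_def finite_SigmaI finite_subset)

text \<open>Vertices of \<open>W\<close> are alone in \<open>d\<close> and in the classes alike, so
  their colors do not matter. A matrix entry thereby becomes a sum over the refinements of one
  partition.\<close>

lemma compatible_iff_color_classes:
  assumes "d \<in> isolating W" "W \<subseteq> verts"
  shows "compatible d g \<longleftrightarrow> same_block d \<subseteq> color_classes W g"
proof -
  have P: "partition_on verts d" and W: "\<And>w. w \<in> W \<Longrightarrow> {w} \<in> d"
    using assms(1) by (auto simp: isolating_def in_diagrams_iff)
  note eq = equiv_same_block[OF P]
  have single: "u = v" if "(u, v) \<in> same_block d" "u \<in> W \<or> v \<in> W" for u v
  proof -
    have "(v, u) \<in> same_block d"
      using that(1) eq by (auto simp: equiv_def dest: symD)
    then show ?thesis
      using that W assms(2) singleton_block_iff[OF P] by blast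
  qed
  have "(u, v) \<in> color_classes W g" if "(u, v) \<in> same_block d" "g u = g v" for u v
    using single[OF that(1)] that eq by (auto simp: color_classes_def equiv_def)
  moreover have "g u = g v" if "(u, v) \<in> color_classes W g" for u v
    using that by (auto simp: color_classes_def)
  ultimately show ?thesis
    unfolding compatible_def by fast
qed

lemma color_classes_isolating:
  assumes "W \<subseteq> verts" "joined \<Longrightarrow> Inl cols \<notin> W \<and> Inr cols \<notin> W \<and> g (Inl cols) = g (Inr cols)"
  shows "verts // color_classes W g \<in> isolating W"
    and "same_block (verts // color_classes W g) = color_classes W g"
proof -
  show sb: "same_block (verts // color_classes W g) = color_classes W g"
    using equiv_color_classes by (rule same_block_quotient)
  have P: "partition_on verts (verts // color_classes W g)"
    using equiv_color_classes by (rule partition_on_quotient)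
  have "(Inl cols, Inr cols) \<in> color_classes W g" if joined
    using assms(2)[OF that] cols_pos[OF that] by (auto simp: color_classes_def vertices_def)
  moreover have "{w} \<in> verts // color_classes W g" if "w \<in> W" for w
    using singleton_block_iff[OF P, of w] that assms(1) unfolding sb by (auto simp: color_classes_def)
  ultimately show "verts // color_classes W g \<in> isolating W"
    using P by (auto simp: isolating_def in_diagrams_iff sb)
qed

lemma card_blocks_le:
  assumes "d \<in> diagrams k" "finite R"
    and "\<And>B. \<lbrakk>B \<in> d; B \<inter> W = {}\<rbrakk> \<Longrightarrow> B \<inter> R \<noteq> {}"
  shows "card {B \<in> d. B \<inter> W = {}} \<le> card R"
proof -
  have "B \<in> (\<lambda>v. same_block d `` {v}) ` R" if B: "B \<in> d" "B \<inter> W = {}" for B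
  proof -
    obtain v where "v \<in> B" "v \<in> R"
      using assms(3)[OF B] by blast
    then show ?thesis
      using same_block_image_eq[OF partition_on_diagram[OF assms(1)] B(1)] by (intro image_eqI) auto
  qed
  then show ?thesis
    using assms(2) by (intro surj_card_le[of R _ "\<lambda>v. same_block d `` {v}"]) blast+
qed

text \<open>Every block is represented by one of its vertices, and in the glued column
  \<open>Inl cols\<close> also represents the block of \<open>Inr cols\<close>.\<close>

lemma card_blocks_le_vertices:
  assumes d: "d \<in> diagrams k" and W: "W \<subseteq> verts" "joined \<Longrightarrow> Inl cols \<notin> W \<and> Inr cols \<notin> W"
  shows "card {B \<in> d. B \<inter> W = {}} \<le> card (verts - W) - of_bool joined"
proof -
  define R where "R = verts - W - (if joined then {Inr cols} else {})"
  have "B \<inter> R \<noteq> {}" if B: "B \<in> d" "B \<inter> W = {}" for B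
  proof -
    have P: "partition_on verts d"
      using d by (rule partition_on_diagram)
    then have "B \<noteq> {}" "B \<subseteq> verts"
      using B(1) by (auto simp: partition_on_def)
    then obtain v where v: "v \<in> B" "v \<in> verts"
      by blast
    have "Inl cols \<in> B \<and> Inl cols \<in> verts" if "joined" "v = Inr cols"
    proof -
      have "(Inr cols, Inl cols) \<in> same_block d"
        using d that(1) by (auto simp: in_diagrams_iff same_block_def)
      then show ?thesis
        using same_block_image_eq[OF P B(1) v(1)] that(2) B(1) P by (auto simp: partition_on_def)
    qed
    then show ?thesis
      using v B by (auto simp: R_def split: if_splits)
  qed
  then have "card {B \<in> d. B \<inter> W = {}} \<le> card R"
    using finite_vertices by (intro card_blocks_le[OF d]) (auto simp: R_def)
  also have "card R = card (verts - W) - of_bool joined"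
    using W(2) cols_pos finite_vertices by (auto simp: R_def card_Diff_subset vertices_def)
  finally show ?thesis .
qed

end

context integer_partition_alg
begin

lemma mat_isolating:
  assumes f: "\<And>d. d \<notin> isolating W \<Longrightarrow> f d = 0" and W: "W \<subseteq> verts"
  shows "mat f t b = (\<Sum>d\<in>{d \<in> isolating W. same_block d \<subseteq> color_classes W (case_sum t b)}. f d)"
proof -
  have "mat f t b = (\<Sum>d\<in>isolating W. f d * of_nat (weight d t b))"
    unfolding mat_def using finite_diagrams isolating_subset f by (intro sum.mono_neutral_right) auto
  also have "\<dots> = (\<Sum>d\<in>isolating W. if same_block d \<subseteq> color_classes W (case_sum t b) then f d else 0)"
    using compatible_iff_color_classes[OF _ W] by (intro sum.cong refl) (simp add: weight_def)
  also have "\<dots> = (\<Sum>d\<in>{d \<in> isolating W. same_block d \<subseteq> color_classes W (case_sum t b)}. f d)"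
    using finite_isolating by (simp add: sum.inter_filter)
  finally show ?thesis .
qed

text \<open>Only the blocks off \<open>W\<close> need different colors: vertices of \<open>W\<close>
  stay isolated in \<open>color_classes W\<close> whatever color they get. So \<open>n\<close> has
  to bound the number of these blocks alone.\<close>

lemma sum_refinements_eq_0:
  assumes f: "\<And>d. d \<notin> isolating W \<Longrightarrow> f d = 0" and W: "W \<subseteq> verts"
    and zero: "\<And>t b. \<lbrakk>t \<in> cs; b \<in> cs\<rbrakk> \<Longrightarrow> mat f t b = 0"
    and d: "d \<in> isolating W" "card {B \<in> d. B \<inter> W = {}} \<le> n" and n: "n > 0"
  shows "(\<Sum>e\<in>{e \<in> isolating W. same_block e \<subseteq> same_block d}. f e) = 0"
proof -
  have P: "partition_on verts d" and single: "\<And>w. w \<in> W \<Longrightarrow> {w} \<in> d"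
    using d(1) by (auto simp: isolating_def in_diagrams_iff)
  have "finite d"
    using finite_vertices P by (rule finite_elements)
  then have "finite {B \<in> d. B \<inter> W = {}}"
    by simp
  then obtain \<phi> where \<phi>: "\<phi> ` {B \<in> d. B \<inter> W = {}} \<subseteq> {..<n}" "inj_on \<phi> {B \<in> d. B \<inter> W = {}}"
    using card_le_inj[of "{B \<in> d. B \<inter> W = {}}" "{..<n}"] d(2) by auto
  \<comment> \<open>The color 0 elsewhere is arbitrary, but it has to be one of the \<open>n\<close>
    colors, hence \<open>n > 0\<close>.\<close>
  define g where "g v = (if v \<in> verts - W then \<phi> (same_block d `` {v}) else 0)" for v
  have blk: "same_block d `` {v} \<in> {B \<in> d. B \<inter> W = {}}" if v: "v \<in> verts - W" for v
  proof -
    obtain B where B: "B \<in> d" "v \<in> B"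
      using P v by (auto simp: partition_on_def)
    have "B \<inter> W = {}"
    proof (rule ccontr)
      assume "B \<inter> W \<noteq> {}"
      then obtain w where "w \<in> B" "w \<in> W"
        by auto
      then have "B = {w}"
        using singleton_block_eq[OF P single B(1)] by blast
      then show False
        using B(2) v \<open>w \<in> W\<close> by auto
    qed
    then show ?thesis
      using B same_block_image_eq[OF P B] by simp
  qed
  have "color_classes W g = same_block d"
  proof -
    have "(u, v) \<in> color_classes W g \<longleftrightarrow> (u, v) \<in> same_block d" if "u \<in> verts" "v \<in> verts" for u v
    proof (cases "u \<in> W \<or> v \<in> W")
      case True
      have "(u, v) \<in> same_block d \<longleftrightarrow> u = v"
      proof
        assume uv: "(u, v) \<in> same_block d"
        then have "(v, u) \<in> same_block d"
          by (auto simp: same_block_def)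
        then show "u = v"
          using uv True single W singleton_block_iff[OF P] by blast
      next
        assume "u = v"
        then show "(u, v) \<in> same_block d"
          using equiv_same_block[OF P] that by (auto simp: equiv_def refl_on_def)
      qed
      then show ?thesis
        using True that by (auto simp: color_classes_def)
    next
      case False
      then have "g u = g v \<longleftrightarrow> same_block d `` {u} = same_block d `` {v}"
        using that blk[of u] blk[of v] inj_on_eq_iff[OF \<phi>(2)] by (simp add: g_def)
      also have "\<dots> \<longleftrightarrow> (u, v) \<in> same_block d"
        using eq_equiv_class_iff[OF equiv_same_block[OF P] that] .
      finally show ?thesis
        using False that by (auto simp: color_classes_def)
    qed
    moreover have "same_block d \<subseteq> verts \<times> verts" "color_classes W g \<subseteq> verts \<times> verts"
      using equiv_same_block[OF P] by (auto simp: equiv_def color_classes_def)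
    ultimately show ?thesis
      by (intro subset_antisym subrelI) blast+
  qed
  moreover define t where "t = (\<lambda>i\<in>{1..cols}. g (Inl i))"
  moreover define b where "b = (\<lambda>i\<in>{1..cols}. g (Inr i))"
  moreover have g_less: "g v < n" for v
    using \<phi>(1) blk[of v] n by (auto simp: g_def)
  moreover have "color_classes W (case_sum t b) = color_classes W g"
    by (auto simp: color_classes_def t_def b_def vertices_def)
  ultimately show ?thesis
    using mat_isolating[OF f W, where t = t and b = b] zero[of t b] by simp
qed

end

section \<open>The case of large $k$\<close>

context half_integer
begin

text \<open>Composed with itself it returns itself and removes one component per column of
  \<open>J\<close>, so it is idempotent up to a power of the parameter. The glued column must stay
  out of \<open>J\<close>.\<close>

definition split_diagram :: "nat set \<Rightarrow> diagram" where
  "split_diagram J = (\<lambda>i. {Inl i, Inr i}) ` ({1..cols} - J) \<union> (\<lambda>i. {Inl i}) ` J \<union> (\<lambda>i. {Inr i}) ` J"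

lemma split_diagram_in_diagrams:
  assumes "J \<subseteq> {1..cols}" "joined \<Longrightarrow> cols \<notin> J"
  shows "split_diagram J \<in> diagrams k"
proof -
  have "partition_on verts (split_diagram J)"
    using assms(1) by (intro partition_onI) (auto simp: vertices_def split_diagram_def disjnt_def)
  moreover have "(Inl cols, Inr cols) \<in> same_block (split_diagram J)" if joined
    using assms(2) cols_pos that unfolding split_diagram_def same_block_def by auto
  ultimately show ?thesis
    by (simp add: in_diagrams_iff)
qed

lemma weight_split_diagram: "weight (split_diagram J) c b = of_bool (\<forall>i\<in>{1..cols} - J. c i = b i)"
proof -
  have "compatible (split_diagram J) (case_sum c b) \<longleftrightarrow> (\<forall>i\<in>{1..cols} - J. c i = b i)"
    unfolding compatible_iff split_diagram_def ball_Un ball_simps by auto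
  then show ?thesis
    by (simp add: weight_def)
qed

lemma compatible_change_isolated:
  assumes d: "partition_on verts d" "\<And>i. i \<in> J \<Longrightarrow> {Inr i} \<in> d"
    and eq: "\<And>i. i \<in> {1..cols} - J \<Longrightarrow> c i = b i" and compat: "compatible d (case_sum t c)"
  shows "compatible d (case_sum t b)"
  unfolding compatible_iff
proof (intro ballI)
  fix B u v assume B: "B \<in> d" "u \<in> B" "v \<in> B"
  have same: "case_sum t c w = case_sum t b w" if w: "w \<in> B" "\<not> (\<exists>i\<in>J. w = Inr i)" for w
  proof (cases w)
    case (Inr i)
    have "w \<in> verts"
      using w(1) B(1) d(1) by (auto simp: partition_on_def)
    with w(2) Inr have "i \<in> {1..cols} - J"
      by (auto simp: vertices_def)
    with Inr show ?thesis
      by (simp add: eq)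
  qed simp
  show "case_sum t b u = case_sum t b v"
  proof (cases "u = v")
    case False
    then have "\<not> (\<exists>i\<in>J. u = Inr i)" "\<not> (\<exists>i\<in>J. v = Inr i)"
      using singleton_block_eq[OF d(1) d(2) B(1)] B(2,3) by blast+
    then have "case_sum t b u = case_sum t c u" "case_sum t b v = case_sum t c v"
      using same B by simp_all
    moreover have "case_sum t c u = case_sum t c v"
      using compat B by (rule compatibleD)
    ultimately show ?thesis
      by (simp only:)
  qed simp
qed

text \<open>An isolated \<open>Inr i\<close> of \<open>d\<close> meets the isolated top vertex of a
  cut column, which makes one removed component for each \<open>i\<close> in \<open>J\<close>. In
  colors: the middle row is free on \<open>J\<close>, where \<open>d\<close> does not notice it, and
  must equal \<open>b\<close> elsewhere.\<close>

lemma compose_split_diagram: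
  assumes d: "d \<in> diagrams k" "\<And>i. i \<in> J \<Longrightarrow> {Inr i} \<in> d"
    and J: "J \<subseteq> {1..cols}" "joined \<Longrightarrow> cols \<notin> J"
  shows "compose_diagrams d (split_diagram J) = d" and "removed d (split_diagram J) = card J"
proof -
  note P = partition_on_diagram[OF d(1)] partition_on_diagram[OF split_diagram_in_diagrams[OF J]]
  have "2 ^ removed d (split_diagram J) * weight (compose_diagrams d (split_diagram J)) t b =
      2 ^ card J * weight d t b" if tb: "t \<in> colorings 2 cols" "b \<in> colorings 2 cols" for t b
  proof -
    define C where "C = {c \<in> colorings 2 cols. \<forall>i\<in>{1..cols} - J. c i = b i}"
    have "2 ^ removed d (split_diagram J) * weight (compose_diagrams d (split_diagram J)) t b =
        (\<Sum>c\<in>colorings 2 cols. weight d t c * weight (split_diagram J) c b)"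
      using sum_weight_weight[OF P tb] by simp
    also have "\<dots> = (\<Sum>c\<in>colorings 2 cols. if \<forall>i\<in>{1..cols} - J. c i = b i then weight d t b else 0)"
    proof (intro sum.cong refl)
      fix c
      have "weight d t c = weight d t b" if "\<forall>i\<in>{1..cols} - J. c i = b i"
        using compatible_change_isolated[OF P(1) d(2), of J c b t]
          compatible_change_isolated[OF P(1) d(2), of J b c t] that
        by (auto simp: weight_def)
      then show "weight d t c * weight (split_diagram J) c b =
          (if \<forall>i\<in>{1..cols} - J. c i = b i then weight d t b else 0)"
        by (simp add: weight_split_diagram)
    qed
    also have "\<dots> = (\<Sum>c\<in>C. weight d t b)"
      unfolding C_def by (rule sum.inter_filter[symmetric, OF finite_colorings])
    also have "\<dots> = card C * weight d t b"
      by simp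
    also have "C = PiE {1..cols} (\<lambda>i. if i \<in> J then {..<2} else {b i})"
    proof (intro subset_antisym subsetI)
      fix c assume c: "c \<in> PiE {1..cols} (\<lambda>i. if i \<in> J then {..<2} else {b i})"
      have "c i \<in> {..<2}" "i \<notin> J \<Longrightarrow> c i = b i" if "i \<in> {1..cols}" for i
        using PiE_mem[OF c that] PiE_mem[OF tb(2) that] by (auto split: if_splits)
      moreover have "c i = undefined" if "i \<notin> {1..cols}" for i
        using PiE_arb[OF c that] .
      ultimately show "c \<in> C"
        unfolding C_def by (auto intro!: PiE_I)
    qed (unfold C_def, auto simp: PiE_iff)
    also have "card \<dots> = (\<Prod>i\<in>{1..cols}. if i \<in> J then 2 else 1)"
      by (subst card_PiE) (auto intro!: prod.cong)
    also have "\<dots> = 2 ^ card J"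
      using J(1) by (simp add: prod.If_cases Int_absorb1 flip: atLeastAtMost_iff)
    finally show ?thesis .
  qed
  from diagram_eqI[OF partition_on_compose[OF P] P(1) this]
  show "compose_diagrams d (split_diagram J) = d" "removed d (split_diagram J) = card J"
    by blast+
qed

end

context integer_partition_alg
begin

text \<open>By Moebius inversion there is a combination of diagrams whose value on a coloring is 1 if the
  coloring separates all vertices outside \<open>W\<close>, and 0 otherwise. With too few colors it vanishes.\<close>

lemma kernel_element:
  assumes W: "W \<subseteq> verts" "joined \<Longrightarrow> Inl cols \<notin> W \<and> Inr cols \<notin> W"
    and n: "n < card (verts - W) - of_bool joined"
  obtains y :: "diagram \<Rightarrow> complex" where "y \<noteq> 0" "\<And>d. d \<notin> isolating W \<Longrightarrow> y d = 0"
    "\<And>t b. \<lbrakk>t \<in> cs; b \<in> cs\<rbrakk> \<Longrightarrow> mat y t b = 0"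
proof -
  \<comment> \<open>Even colors above and odd ones below are pairwise different, except that the
    glued column gets one color. \<open>g0\<close> is not limited to \<open>n\<close> colors; it
    only serves to describe the finest diagram \<open>s0\<close>.\<close>
  define g0 :: "nat + nat \<Rightarrow> nat" where
    "g0 = case_sum (\<lambda>i. 2 * i) (\<lambda>i. if joined \<and> i = cols then 2 * cols else 2 * i + 1)"
  define s0 where "s0 = verts // color_classes W g0"
  have s0: "s0 \<in> isolating W" "same_block s0 = color_classes W g0"
    using color_classes_isolating[of W g0] W unfolding s0_def by (auto simp: g0_def)
  define R where "R = verts - W - (if joined then {Inr cols} else {})"
  have "inj_on g0 R"
    by (rule inj_onI) (auto simp: g0_def R_def split: sum.splits if_splits, presburger+)
  have "card R = card (verts - W) - of_bool joined"
    using W(2) cols_pos finite_vertices by (auto simp: R_def card_Diff_subset vertices_def)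
  with n have card_R: "n < card R"
    by simp
  have "inj_on same_block (isolating W)"
    using inj_same_block isolating_subset by (rule inj_on_subset)
  from zeta_solvable[OF finite_isolating this, of "\<lambda>s. if s = s0 then 1 else 0 :: complex"]
  obtain y :: "diagram \<Rightarrow> complex" where y: "\<And>s. s \<notin> isolating W \<Longrightarrow> y s = 0"
    "\<And>s. s \<in> isolating W \<Longrightarrow>
      (\<Sum>e\<in>{e \<in> isolating W. same_block e \<subseteq> same_block s}. y e) = (if s = s0 then 1 else 0)"
    by blast
  have "y \<noteq> 0"
  proof
    assume "y = 0"
    with y(2)[OF s0(1)] show False
      by simp
  qed
  moreover have "mat y t b = 0" if tb: "t \<in> cs" "b \<in> cs" for t b
  proof -
    define g where "g = case_sum t b"
    have mat: "mat y t b = (\<Sum>e\<in>{e \<in> isolating W. same_block e \<subseteq> color_classes W g}. y e)"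
      unfolding g_def by (rule mat_isolating[OF y(1) W(1)])
    show ?thesis
    proof (cases "joined \<and> g (Inl cols) \<noteq> g (Inr cols)")
      case True
      then have "(Inl cols, Inr cols) \<notin> color_classes W g"
        by (auto simp: color_classes_def)
      \<comment> \<open>Every diagram joins the last column, so a coloring that differs there is
        compatible with none of them.\<close>
      then have "{e \<in> isolating W. same_block e \<subseteq> color_classes W g} = {}"
        using True by (auto simp: isolating_def in_diagrams_iff)
      with mat show ?thesis
        by simp
    next
      case False
      define s where "s = verts // color_classes W g"
      have s: "s \<in> isolating W" "same_block s = color_classes W g"
        using color_classes_isolating[of W g] W False unfolding s_def by auto
      \<comment> \<open>Pigeonhole: with fewer colors than vertices in \<open>R\<close>, two of
        these share a class, whereas \<open>g0\<close> separates them.\<close>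
      have "s \<noteq> s0"
      proof
        assume "s = s0"
        then have eq: "color_classes W g = color_classes W g0"
          using s(2) s0(2) by simp
        have "t i < n" "b i < n" if "i \<in> {1..cols}" for i
          using tb PiE_mem[OF _ that] by auto
        then have "g ` R \<subseteq> {..<n}"
          by (auto simp: g_def R_def vertices_def)
        then have "\<not> inj_on g R"
          using card_R card_inj_on_le[of g R "{..<n}"] by auto
        then obtain u v where uv: "u \<in> R" "v \<in> R" "u \<noteq> v" "g u = g v"
          by (auto simp: inj_on_def)
        then have "(u, v) \<in> color_classes W g"
          by (auto simp: color_classes_def R_def)
        then have "g0 u = g0 v"
          unfolding eq by (auto simp: color_classes_def)
        with \<open>inj_on g0 R\<close> uv show False
          by (auto dest: inj_onD)
      qed
      then show ?thesis
        using y(2)[OF s(1)] s(2) mat by simp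
    qed
  qed
  ultimately show ?thesis
    using y(1) by (intro that)
qed

lemma scale_mult: "scale_fun c f \<otimes>\<^bsub>PA\<^esub> g = scale_fun c (f \<otimes>\<^bsub>PA\<^esub> g)"
proof
  fix e
  show "(scale_fun c f \<otimes>\<^bsub>PA\<^esub> g) e = scale_fun c (f \<otimes>\<^bsub>PA\<^esub> g) e"
    unfolding scale_fun_apply mult_eq sum_distrib_left
    by (intro sum.cong refl) simp
qed

lemma not_semisimple:
  assumes n: "n \<ge> 2" and large: "n + 2 + of_bool joined \<le> 2 * cols"
  shows "\<not> semisimple_algebra PA"
proof
  assume semisimple: "semisimple_algebra PA"
  define m where "m = cols - of_bool joined"
  \<comment> \<open>Besides a glued last column, the columns 1 to \<open>j\<close> are kept. Here
    \<open>j\<close> is maximal with \<open>2 * j + of_bool joined \<le> n\<close>: off the isolated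
    vertices the diagrams of pAp have at most \<open>n\<close> blocks, while those of Ap, which lose
    only the bottom vertices of \<open>J\<close>, can have
    \<open>m + j + of_bool joined > n\<close>.\<close>
  define j where "j = (n - of_bool joined) div 2"
  define J where "J = {j + 1..m}"
  define p where "p = split_diagram J"
  define Wy where "Wy = (Inr ` J :: (nat + nat) set)"
  define Wz where "Wz = (Inl ` J \<union> Inr ` J :: (nat + nat) set)"
  have J: "J \<subseteq> {1..cols}" "joined \<Longrightarrow> cols \<notin> J"
    using cols_pos by (auto simp: J_def m_def)
  have card_J: "card J = m - j" and m: "cols = m + of_bool joined" and jm: "j \<le> m"
    using cols_pos n large by (auto simp: J_def m_def j_def)
  have bounds: "2 * j + of_bool joined \<le> n" "n < m + j + of_bool joined"
    using n large unfolding j_def m by (auto split: if_splits)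
  have card_verts: "card verts = 2 * cols"
    unfolding vertices_def by (subst card_Un_disjoint) (auto simp: card_image)
  have finJ: "finite J"
    by (simp add: J_def)
  have Wy: "Wy \<subseteq> verts" "joined \<Longrightarrow> Inl cols \<notin> Wy \<and> Inr cols \<notin> Wy"
    using J by (auto simp: Wy_def vertices_def)
  have card_Wy: "card (verts - Wy) = 2 * cols - card J"
    using finJ card_verts card_Diff_subset[OF _ Wy(1)] by (simp add: Wy_def card_image)
  have "card Wz = 2 * card J"
    unfolding Wz_def using finJ by (subst card_Un_disjoint) (auto simp: card_image)
  moreover have Wz: "Wz \<subseteq> verts" "joined \<Longrightarrow> Inl cols \<notin> Wz \<and> Inr cols \<notin> Wz"
    using J by (auto simp: Wz_def vertices_def)
  ultimately have card_Wz: "card (verts - Wz) = 2 * cols - 2 * card J"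
    using finJ card_verts card_Diff_subset[OF _ Wz(1)] by (simp add: Wz_def)
  have "n < card (verts - Wy) - of_bool joined"
    using bounds jm unfolding card_Wy card_J by (cases joined) (simp_all add: m)
  from kernel_element[OF Wy(1,2) this] obtain y where y: "y \<noteq> 0"
      "\<And>d. d \<notin> isolating Wy \<Longrightarrow> y d = 0" "\<And>t b. \<lbrakk>t \<in> cs; b \<in> cs\<rbrakk> \<Longrightarrow> mat y t b = 0"
    by blast
  define e where "e = (\<lambda>d. if d = p then 1 else 0 :: complex)"
  have p: "p \<in> diagrams k"
    unfolding p_def using J by (rule split_diagram_in_diagrams)
  have carrier: "y \<in> carrier PA" "e \<in> carrier PA"
    using y(2) isolating_subset p by (auto simp: carrier_PA e_def)
  \<comment> \<open>On the support of \<open>y\<close>, right multiplication by \<open>p\<close> is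
    a nonzero scalar, which lets \<open>e\<close> be inserted behind \<open>y\<close> below.\<close>
  have ye: "y \<otimes>\<^bsub>PA\<^esub> e = scale_fun (of_nat n ^ card J) y"
  proof
    fix d
    have "(y \<otimes>\<^bsub>PA\<^esub> e) d = (\<Sum>d1\<in>diagrams k. if d1 = d then of_nat n ^ card J * y d1 else 0)"
      unfolding mult_eq
    proof (intro sum.cong refl)
      fix d1 assume d1: "d1 \<in> diagrams k"
      have "(\<Sum>d2\<in>diagrams k. if compose_diagrams d1 d2 = d then y d1 * e d2 * of_nat n ^ removed d1 d2 else 0) =
          (\<Sum>d2\<in>diagrams k. if d2 = p then if compose_diagrams d1 p = d then y d1 * of_nat n ^ removed d1 p else 0 else 0)"
        by (intro sum.cong refl) (simp add: e_def)
      also have "\<dots> = (if compose_diagrams d1 p = d then y d1 * of_nat n ^ removed d1 p else 0)"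
        using finite_diagrams p by simp
      also have "\<dots> = (if d1 = d then of_nat n ^ card J * y d1 else 0)"
      proof (cases "d1 \<in> isolating Wy")
        case True
        then have "compose_diagrams d1 p = d1" "removed d1 p = card J"
          unfolding p_def using compose_split_diagram[OF d1 _ J] by (auto simp: isolating_def Wy_def)
        then show ?thesis
          by auto
      next
        case False
        then show ?thesis
          using y(2)[OF False] by auto
      qed
      finally show "(\<Sum>d2\<in>diagrams k. if compose_diagrams d1 d2 = d then y d1 * e d2 * of_nat n ^ removed d1 d2 else 0) =
          (if d1 = d then of_nat n ^ card J * y d1 else 0)" .
    qed
    also have "\<dots> = scale_fun (of_nat n ^ card J) y d"
      using finite_diagrams carrier(1) by (simp add: carrier_PA)
    finally show "(y \<otimes>\<^bsub>PA\<^esub> e) d = scale_fun (of_nat n ^ card J) y d" .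
  qed
  have "y \<otimes>\<^bsub>PA\<^esub> (a \<otimes>\<^bsub>PA\<^esub> y) = 0" if a: "a \<in> carrier PA" for a
  proof -
    \<comment> \<open>Up to that scalar, \<open>y a y\<close> is \<open>y z\<close>. The factor
      \<open>z\<close> is supported on diagrams isolating both rows of \<open>J\<close> and acts as
      0 because \<open>y\<close> does, so the block count forces \<open>z = 0\<close>.\<close>
    define z where "z = e \<otimes>\<^bsub>PA\<^esub> (a \<otimes>\<^bsub>PA\<^esub> y)"
    have support: "d \<in> isolating Wz" if "z d \<noteq> 0" for d
    proof -
      obtain d1 where d1: "d1 \<in> diagrams k" "compose_diagrams p d1 = d" "(a \<otimes>\<^bsub>PA\<^esub> y) d1 \<noteq> 0"
        using \<open>z d \<noteq> 0\<close> unfolding z_def by (rule mult_support) (auto simp: e_def split: if_splits)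
      obtain d2 d3 where d23: "d2 \<in> diagrams k" "d3 \<in> diagrams k" "y d3 \<noteq> 0" "compose_diagrams d2 d3 = d1"
        using d1(3) by (rule mult_support) blast
      have "{Inr i} \<in> d3" if "i \<in> J" for i
        using y(2)[of d3] d23(3) that by (auto simp: isolating_def Wy_def)
      then have d1_J: "{Inr i} \<in> d1" if "i \<in> J" for i
        unfolding d23(4)[symmetric] using d23 J(1) that
        by (intro singleton_block_compose_right[of cols] partition_on_diagram) auto
      have "{Inr i} \<in> d" if "i \<in> J" for i
        unfolding d1(2)[symmetric] using d1 p J(1) that d1_J[OF that]
        by (intro singleton_block_compose_right[of cols] partition_on_diagram) auto
      moreover have "{Inl i} \<in> d" if "i \<in> J" for i
        unfolding d1(2)[symmetric] using d1 p J(1) that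
        by (intro singleton_block_compose_left[of cols] partition_on_diagram) (auto simp: p_def split_diagram_def)
      moreover have "d \<in> diagrams k"
        using compose_in_diagrams[OF p d1(1)] d1(2) by simp
      ultimately show ?thesis
        by (auto simp: isolating_def Wz_def)
    qed
    have zero: "mat z t b = 0" if tb: "t \<in> cs" "b \<in> cs" for t b
      unfolding z_def mat_mult[OF tb] using tb y(3) by (simp add: mat_mult[OF _ tb(2)])
    have "z = 0"
    proof
      fix d
      have "(\<Sum>f\<in>{f \<in> isolating Wz. same_block f \<subseteq> same_block d}. z f) = 0" if d: "d \<in> isolating Wz" for d
      proof (rule sum_refinements_eq_0[OF _ Wz(1) zero d])
        have "card {B \<in> d. B \<inter> Wz = {}} \<le> 2 * cols - 2 * card J - of_bool joined"
          using card_blocks_le_vertices[OF subsetD[OF isolating_subset d] Wz] unfolding card_Wz .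
        also have "\<dots> \<le> n"
          using bounds jm unfolding card_J by (cases joined) (simp_all add: m)
        finally show "card {B \<in> d. B \<inter> Wz = {}} \<le> n" .
      qed (use support n in auto)
      moreover have "inj_on same_block (isolating Wz)"
        using inj_same_block isolating_subset by (rule inj_on_subset)
      ultimately have "z d = 0" if "d \<in> isolating Wz"
        using that finite_same_block isolating_subset
        by (intro zeta_injective[OF finite_isolating]) auto
      then show "z d = 0 d"
        using support by auto
    qed
    have "scale_fun (of_nat n ^ card J) (y \<otimes>\<^bsub>PA\<^esub> (a \<otimes>\<^bsub>PA\<^esub> y)) = (y \<otimes>\<^bsub>PA\<^esub> e) \<otimes>\<^bsub>PA\<^esub> (a \<otimes>\<^bsub>PA\<^esub> y)"
      by (simp only: ye scale_mult)
    also have "\<dots> = y \<otimes>\<^bsub>PA\<^esub> z"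
      unfolding z_def by (rule mult_assoc_PA)
    also have "\<dots> = y \<otimes>\<^bsub>PA\<^esub> scale_fun 0 0"
      using \<open>z = 0\<close> by (simp add: scale_fun_def zero_fun_def)
    also have "\<dots> = 0"
      unfolding mult_scale by (simp add: fun_eq_iff)
    finally show ?thesis
      using n by (simp add: fun_eq_iff)
  qed
  with semisimple_imp_semiprime[OF semisimple carrier(1)] y(1) show False
    by blast
qed

end

section \<open>Permutation diagrams\<close>

text \<open>Moebius inversion on a Boolean lattice: the signs of the subsets of a nonempty set sum
  to 0, so alternating signs solve the recursion.\<close>

lemma mobius_Pow:
  fixes q :: "'a set \<Rightarrow> 'b::comm_ring_1"
  assumes "finite S" "\<And>T. \<lbrakk>T \<subseteq> S; T \<noteq> {}\<rbrakk> \<Longrightarrow> (\<Sum>U\<in>Pow T. q U) = 0"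
  shows "q S = (-1) ^ card S * q {}"
  using assms
proof (induction S rule: finite_psubset_induct)
  case (psubset S)
  show ?case
  proof (cases "S = {}")
    case False
    have IH: "q U = (-1) ^ card U * q {}" if "U \<in> Pow S - {S}" for U
    proof (rule psubset.IH)
      show "U \<subset> S"
        using that by auto
      show "(\<Sum>V\<in>Pow T. q V) = 0" if T: "T \<subseteq> U" "T \<noteq> {}" for T
        using psubset.prems[of T] T \<open>U \<subset> S\<close> by auto
    qed
    have finP: "finite (Pow S)" "S \<in> Pow S"
      using psubset.hyps by auto
    \<comment> \<open>Expansion of a product with one factor \<open>-1 + 1\<close> for each element
      of \<open>S\<close>.\<close>
    have "(\<Sum>U\<in>Pow S. (-1 :: 'b) ^ card U) = (\<Prod>s\<in>S. -1 + 1)"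
      using prod_add[OF psubset.hyps, of "\<lambda>_. -1 :: 'b" "\<lambda>_. 1"] by simp
    also have "\<dots> = 0"
      using False psubset.hyps by (simp add: card_gt_0_iff zero_power)
    finally have alt: "(\<Sum>U\<in>Pow S. (-1 :: 'b) ^ card U) = 0" .
    have "0 = (\<Sum>U\<in>Pow S. q U)"
      using psubset.prems[of S] False by simp
    also have "\<dots> = q S + (\<Sum>U\<in>Pow S - {S}. (-1) ^ card U * q {})"
      unfolding sum.remove[OF finP] using IH by (intro arg_cong2[of _ _ _ _ "(+)"] sum.cong refl) auto
    also have "(\<Sum>U\<in>Pow S - {S}. (-1) ^ card U * q {}) = ((\<Sum>U\<in>Pow S. (-1) ^ card U) - (-1) ^ card S) * q {}"
      unfolding sum.remove[OF finP] by (simp add: sum_distrib_right)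
    finally show ?thesis
      unfolding alt by (simp add: algebra_simps add_eq_0_iff)
  qed simp
qed

context half_integer
begin

text \<open>The equivalence relation of a partial matching with strands from top \<open>i\<close> to
  bottom \<open>\<sigma> i\<close> for \<open>i\<close> in \<open>T\<close>. Letting
  \<open>T\<close> vary describes the refinements of one permutation diagram by subsets.\<close>

definition pairs :: "(nat \<Rightarrow> nat) \<Rightarrow> nat set \<Rightarrow> ((nat + nat) \<times> (nat + nat)) set" where
  "pairs \<sigma> T = Id_on verts \<union> (\<lambda>i. (Inl i, Inr (\<sigma> i))) ` T \<union> (\<lambda>i. (Inr (\<sigma> i), Inl i)) ` T"

abbreviation perms :: "(nat \<Rightarrow> nat) set" where
  "perms \<equiv> {\<sigma>. bij_betw \<sigma> {1..cols} {1..cols}}"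

definition is_perm :: "diagram \<Rightarrow> bool" where
  "is_perm d \<longleftrightarrow> (\<exists>\<sigma>\<in>perms. same_block d = pairs \<sigma> {1..cols})"

lemma perm_in: "\<lbrakk>\<sigma> \<in> perms; i \<in> {1..cols}\<rbrakk> \<Longrightarrow> \<sigma> i \<in> {1..cols}"
  using bij_betwE by blast

lemma perm_eq_iff: "\<lbrakk>\<sigma> \<in> perms; i \<in> {1..cols}; j \<in> {1..cols}\<rbrakk> \<Longrightarrow> \<sigma> i = \<sigma> j \<longleftrightarrow> i = j"
  using inj_on_eq_iff[OF bij_betw_imp_inj_on, of \<sigma> "{1..cols}" "{1..cols}" i j] by blast

lemma pairs_iff:
  "(Inl i, Inl j) \<in> pairs \<sigma> T \<longleftrightarrow> i = j \<and> i \<in> {1..cols}"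
  "(Inr i, Inr j) \<in> pairs \<sigma> T \<longleftrightarrow> i = j \<and> i \<in> {1..cols}"
  "(Inl i, Inr j) \<in> pairs \<sigma> T \<longleftrightarrow> i \<in> T \<and> j = \<sigma> i"
  "(Inr j, Inl i) \<in> pairs \<sigma> T \<longleftrightarrow> i \<in> T \<and> j = \<sigma> i"
  by (auto simp: pairs_def vertices_def)

lemma pair_set_eqI:
  fixes r s :: "(('a + 'b) \<times> ('a + 'b)) set"
  assumes "\<And>i j. (Inl i, Inl j) \<in> r \<longleftrightarrow> (Inl i, Inl j) \<in> s" "\<And>i j. (Inr i, Inr j) \<in> r \<longleftrightarrow> (Inr i, Inr j) \<in> s"
    "\<And>i j. (Inl i, Inr j) \<in> r \<longleftrightarrow> (Inl i, Inr j) \<in> s" "\<And>i j. (Inr i, Inl j) \<in> r \<longleftrightarrow> (Inr i, Inl j) \<in> s"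
  shows "r = s"
proof (rule Set.set_eqI)
  fix x :: "('a + 'b) \<times> ('a + 'b)"
  obtain u v where "x = (u, v)"
    by (rule prod.exhaust)
  then show "x \<in> r \<longleftrightarrow> x \<in> s"
    by (cases u; cases v) (simp_all add: assms)
qed

lemma equiv_pairs:
  assumes "\<sigma> \<in> perms" "T \<subseteq> {1..cols}"
  shows "equiv verts (pairs \<sigma> T)"
proof (rule equivI)
  show "pairs \<sigma> T \<subseteq> verts \<times> verts"
    using perm_in[OF assms(1)] assms(2) unfolding pairs_def vertices_def by auto
  show "refl_on verts (pairs \<sigma> T)"
    by (auto simp: refl_on_def pairs_def)
  show "sym (pairs \<sigma> T)"
    by (auto simp: sym_def pairs_def)
  have eq: "i = j" if "\<sigma> i = \<sigma> j" "i \<in> T" "j \<in> T" for i j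
    using perm_eq_iff[OF assms(1)] that assms(2) by (meson subsetD)
  have "(u, w) \<in> pairs \<sigma> T" if "(u, v) \<in> pairs \<sigma> T" "(v, w) \<in> pairs \<sigma> T" for u v w
  proof (cases "u = v \<or> v = w")
    case True
    with that show ?thesis
      by auto
  next
    case False
    then have "u = w" "u \<in> verts"
      using that eq perm_in[OF assms(1)] assms(2) unfolding pairs_def vertices_def by auto
    then show ?thesis
      unfolding pairs_def by (blast intro: Id_onI)
  qed
  then show "trans (pairs \<sigma> T)"
    by (auto simp: trans_def)
qed

lemma matching:
  assumes "\<sigma> \<in> perms" "T \<subseteq> {1..cols}"
  shows "partition_on verts (verts // pairs \<sigma> T)" "same_block (verts // pairs \<sigma> T) = pairs \<sigma> T"
  using equiv_pairs[OF assms] by (simp_all add: partition_on_quotient same_block_quotient)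

lemma compatible_pairs:
  assumes "same_block d = pairs \<sigma> T"
  shows "compatible d (case_sum t b) \<longleftrightarrow> (\<forall>i\<in>T. t i = b (\<sigma> i))"
proof -
  have "compatible d (case_sum t b) \<longleftrightarrow>
      (\<forall>(u, v)\<in>(\<lambda>i. (Inl i, Inr (\<sigma> i))) ` T \<union> (\<lambda>i. (Inr (\<sigma> i), Inl i)) ` T. case_sum t b u = case_sum t b v)"
    unfolding compatible_def assms pairs_def by (simp add: ball_Un Id_on_def)
  also have "\<dots> \<longleftrightarrow> (\<forall>i\<in>T. t i = b (\<sigma> i))"
    unfolding ball_Un ball_simps by (auto dest: bspec)
  finally show ?thesis .
qed

text \<open>The bottom coloring forces the middle coloring \<open>c0\<close>, so the matrix product
  has only entries 0 and 1. This yields the permutation \<open>\<tau> \<circ> \<sigma>\<close> and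
  leaves no room for a removed component.\<close>

lemma perm_compose:
  assumes d: "partition_on verts d1" "partition_on verts d2" and perm: "is_perm d1" "is_perm d2"
  shows "is_perm (compose_diagrams d1 d2)" and "removed d1 d2 = 0"
proof -
  obtain \<sigma> \<tau> where \<sigma>: "\<sigma> \<in> perms" "same_block d1 = pairs \<sigma> {1..cols}"
    and \<tau>: "\<tau> \<in> perms" "same_block d2 = pairs \<tau> {1..cols}"
    using perm by (auto simp: is_perm_def)
  have comp: "\<tau> \<circ> \<sigma> \<in> perms"
    using \<sigma>(1) \<tau>(1) by (auto intro: bij_betw_trans)
  define e where "e = verts // pairs (\<tau> \<circ> \<sigma>) {1..cols}"
  note e = matching[OF comp order_refl, folded e_def]
  have "2 ^ removed d1 d2 * weight (compose_diagrams d1 d2) t b = 2 ^ 0 * weight e t b"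
    if tb: "t \<in> colorings 2 cols" "b \<in> colorings 2 cols" for t b
  proof -
    define c0 where "c0 = (\<lambda>i\<in>{1..cols}. b (\<tau> i))"
    have c0: "c0 \<in> colorings 2 cols"
      unfolding c0_def using PiE_mem[OF tb(2) perm_in[OF \<tau>(1)]] by auto
    have "weight d1 t c * weight d2 c b = (if c = c0 then weight e t b else 0)"
      if c: "c \<in> colorings 2 cols" for c
    proof (cases "c = c0")
      case True
      have "compatible d2 (case_sum c0 b)" "compatible d1 (case_sum t c0) \<longleftrightarrow> compatible e (case_sum t b)"
        using perm_in[OF \<sigma>(1)]
        unfolding compatible_pairs[OF \<sigma>(2)] compatible_pairs[OF \<tau>(2)] compatible_pairs[OF e(2)]
        by (simp_all add: c0_def)
      with True show ?thesis
        by (simp add: weight_def)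
    next
      case False
      then have "\<exists>i\<in>{1..cols}. c i \<noteq> c0 i"
        using PiE_ext[OF c c0] by blast
      then have "\<not> compatible d2 (case_sum c b)"
        unfolding compatible_pairs[OF \<tau>(2)] by (auto simp: c0_def)
      with False show ?thesis
        by (simp add: weight_def)
    qed
    then have "(\<Sum>c\<in>colorings 2 cols. weight d1 t c * weight d2 c b) =
        (\<Sum>c\<in>colorings 2 cols. if c = c0 then weight e t b else 0)"
      by (intro sum.cong refl)
    also have "\<dots> = weight e t b"
      using c0 by (simp add: finite_PiE)
    finally show ?thesis
      using sum_weight_weight[OF d tb] by simp
  qed
  from diagram_eqI[OF partition_on_compose[OF d] e(1) this]
  show "is_perm (compose_diagrams d1 d2)" "removed d1 d2 = 0"
    using e(2) comp unfolding is_perm_def by auto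
qed

lemma is_perm_flip:
  assumes "is_perm d"
  shows "is_perm (flip d)"
proof -
  obtain \<sigma> where \<sigma>: "\<sigma> \<in> perms" "same_block d = pairs \<sigma> {1..cols}"
    using assms by (auto simp: is_perm_def)
  define \<tau> where "\<tau> = inv_into {1..cols} \<sigma>"
  have \<tau>: "\<tau> \<in> perms"
    unfolding \<tau>_def using \<sigma>(1) bij_betw_inv_into by auto
  have inv: "\<tau> (\<sigma> i) = i" "\<sigma> (\<tau> i) = i" if "i \<in> {1..cols}" for i
    using \<sigma>(1) that unfolding \<tau>_def
    by (auto simp: bij_betw_inv_into_left bij_betw_inv_into_right)
  let ?s = "case_sum Inr Inl :: nat + nat \<Rightarrow> nat + nat"
  have swap: "?s (?s v) = v" for v
    by (cases v) auto
  have flip: "(u, v) \<in> same_block (flip d) \<longleftrightarrow> (?s u, ?s v) \<in> same_block d" for u v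
  proof -
    have "u \<in> ?s ` B \<longleftrightarrow> ?s u \<in> B" for u B
      using swap by (metis image_eqI image_iff)
    then show ?thesis
      by (auto simp: same_block_def flip_def)
  qed
  have "(i \<in> {1..cols} \<and> j = \<tau> i) \<longleftrightarrow> (j \<in> {1..cols} \<and> i = \<sigma> j)" for i j
    using inv[of i] inv[of j] perm_in[OF \<sigma>(1), of j] perm_in[OF \<tau>, of i] by metis
  then have "same_block (flip d) = pairs \<tau> {1..cols}"
    by (intro pair_set_eqI) (simp_all add: flip \<sigma>(2) pairs_iff)
  with \<tau> show ?thesis
    by (auto simp: is_perm_def)
qed

text \<open>Colorings show that every top vertex of \<open>d1\<close> reaches the bottom row of
  \<open>d1\<close> and that no two top vertices are joined. Choosing a partner for each is then an
  injection of a finite set into itself, hence a permutation, and nothing else can be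
  joined.\<close>

lemma perm_compose_left:
  assumes d: "partition_on verts d1" "partition_on verts d2" and perm: "is_perm (compose_diagrams d1 d2)"
  shows "is_perm d1"
proof -
  obtain \<sigma> where \<sigma>: "\<sigma> \<in> perms" "same_block (compose_diagrams d1 d2) = pairs \<sigma> {1..cols}"
    using perm by (auto simp: is_perm_def)
  note compat = compatible_pairs[OF \<sigma>(2)]
  note eq = equiv_same_block[OF d(1)]
  have sym: "(v, u) \<in> same_block d1" if "(u, v) \<in> same_block d1" for u v
    using that by (auto simp: same_block_def)
  have trans: "(u, w) \<in> same_block d1" if "(u, v) \<in> same_block d1" "(v, w) \<in> same_block d1" for u v w
    using that eq by (meson equivE transD)
  have refl: "(u, u) \<in> same_block d1" if "u \<in> verts" for u
    using that eq by (meson equivE refl_onD)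
  have dom: "u \<in> verts" "v \<in> verts" if "(u, v) \<in> same_block d1" for u v
    using that eq by (auto simp: equiv_def)
  have "\<exists>j. (Inl i, Inr j) \<in> same_block d1" if i: "i \<in> {1..cols}" for i
  proof (rule ccontr)
    assume no: "\<nexists>j. (Inl i, Inr j) \<in> same_block d1"
    \<comment> \<open>If the block of \<open>Inl i\<close> had no bottom vertex, its indicator would
      be 0 on the middle row and extend by 0 to the bottom, where the permutation demands color
      1.\<close>
    define g :: "nat + nat \<Rightarrow> nat" where "g v = (if (Inl i, v) \<in> same_block d1 then 1 else 0)" for v
    define t :: "nat \<Rightarrow> nat" where "t = (\<lambda>i'\<in>{1..cols}. g (Inl i'))"
    define z :: "nat \<Rightarrow> nat" where "z = (\<lambda>i\<in>{1..cols}. 0)"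
    have col: "t \<in> colorings 2 cols" "z \<in> colorings 2 cols"
      by (auto simp: t_def z_def g_def)
    have "g u = g v" if "(u, v) \<in> same_block d1" for u v
    proof -
      have "(Inl i, u) \<in> same_block d1 \<longleftrightarrow> (Inl i, v) \<in> same_block d1"
        using trans[OF _ that] trans[OF _ sym[OF that]] by blast
      then show ?thesis
        by (simp add: g_def)
    qed
    then have "compatible d1 g"
      unfolding compatible_def by blast
    from iffD2[OF compatible_restrict[OF d(1)] this] have "compatible d1 (case_sum t z)"
      using no by (simp add: t_def z_def g_def)
    moreover have "compatible d2 (case_sum z z)"
      using compatible_restrict[OF d(2), of "\<lambda>_. 0 :: nat"] by (simp add: compatible_def z_def)
    ultimately have "compatible (compose_diagrams d1 d2) (case_sum t z)"
      unfolding compatible_compose_iff[OF d col zero_less_numeral] by (intro bexI[of _ z] conjI col(2))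
    then have "t i = z (\<sigma> i)"
      using i unfolding compat by blast
    moreover have "Inl i \<in> verts"
      using i by (simp add: vertices_def)
    ultimately show False
      using i refl[of "Inl i"] perm_in[OF \<sigma>(1) i] by (simp add: t_def z_def g_def)
  qed
  then obtain f where f: "\<And>i. i \<in> {1..cols} \<Longrightarrow> (Inl i, Inr (f i)) \<in> same_block d1"
    by metis
  have tops: "i = j" if ij: "(Inl i, Inl j) \<in> same_block d1" for i j
  proof -
    have S: "i \<in> {1..cols}" "j \<in> {1..cols}"
      using dom[OF ij] by (auto simp: vertices_def)
    \<comment> \<open>Only \<open>\<sigma> i\<close> has color 1 at the bottom, and the top row
      copies the colors of its partners. If \<open>i\<close> and \<open>j\<close> are joined, then
      \<open>\<sigma> j\<close> has color 1 as well.\<close>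
    define b :: "nat \<Rightarrow> nat" where "b = (\<lambda>j\<in>{1..cols}. if j = \<sigma> i then 1 else 0)"
    define t where "t = (\<lambda>j\<in>{1..cols}. b (\<sigma> j))"
    have b: "b \<in> colorings 2 cols"
      by (simp add: b_def)
    have "b (\<sigma> j) < 2" if "j \<in> {1..cols}" for j
      using PiE_mem[OF b perm_in[OF \<sigma>(1) that]] by simp
    then have t: "t \<in> colorings 2 cols"
      by (auto simp: t_def)
    have "compatible (compose_diagrams d1 d2) (case_sum t b)"
      unfolding compat by (simp add: t_def)
    then obtain c where "compatible d1 (case_sum t c)"
      unfolding compatible_compose_iff[OF d t b zero_less_numeral] by blast
    then have "case_sum t c (Inl i) = case_sum t c (Inl j)"
      using ij unfolding compatible_def by blast
    then have "b (\<sigma> i) = b (\<sigma> j)"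
      using S by (simp add: t_def)
    moreover have "b (\<sigma> i) = 1"
      using perm_in[OF \<sigma>(1) S(1)] by (simp add: b_def)
    moreover have "b (\<sigma> j) = 0" if "\<sigma> j \<noteq> \<sigma> i"
      using perm_in[OF \<sigma>(1) S(2)] that by (simp add: b_def)
    ultimately have "\<sigma> i = \<sigma> j"
      by (metis zero_neq_one)
    then show ?thesis
      unfolding perm_eq_iff[OF \<sigma>(1) S] .
  qed
  have sub: "f ` {1..cols} \<subseteq> {1..cols}"
  proof (rule image_subsetI)
    fix i assume "i \<in> {1..cols}"
    from dom(2)[OF f[OF this]] show "f i \<in> {1..cols}"
      by (auto simp: vertices_def)
  qed
  have inj: "inj_on f {1..cols}"
  proof (rule inj_onI)
    fix i j assume "i \<in> {1..cols}" "j \<in> {1..cols}" "f i = f j"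
    then have "(Inl i, Inl j) \<in> same_block d1"
      using f trans sym by metis
    then show "i = j"
      by (rule tops)
  qed
  have "f ` {1..cols} = {1..cols}"
    using sub inj by (intro endo_inj_surj finite_atLeastAtMost)
  with inj have f_perm: "f \<in> perms"
    by (simp add: bij_betw_def)
  have bottoms: "\<exists>i\<in>{1..cols}. j = f i" if "j \<in> {1..cols}" for j
    using \<open>f ` {1..cols} = {1..cols}\<close> that by blast
  have mixed: "(Inl i, Inr j) \<in> same_block d1 \<longleftrightarrow> i \<in> {1..cols} \<and> j = f i" for i j
  proof
    assume ij: "(Inl i, Inr j) \<in> same_block d1"
    then have S: "i \<in> {1..cols}" "j \<in> {1..cols}"
      using dom[OF ij] by (auto simp: vertices_def)
    then obtain i' where i': "i' \<in> {1..cols}" "j = f i'"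
      using bottoms by blast
    then have "(Inl i, Inl i') \<in> same_block d1"
      using ij f trans sym by metis
    with i' S show "i \<in> {1..cols} \<and> j = f i"
      using tops by blast
  qed (use f in auto)
  have "same_block d1 = pairs f {1..cols}"
  proof (rule pair_set_eqI)
    fix i j
    show "(Inl i, Inl j) \<in> same_block d1 \<longleftrightarrow> (Inl i, Inl j) \<in> pairs f {1..cols}"
      using tops[of i j] dom[of "Inl i" "Inl j"] refl[of "Inl i"] unfolding pairs_iff vertices_def by auto
    show "(Inl i, Inr j) \<in> same_block d1 \<longleftrightarrow> (Inl i, Inr j) \<in> pairs f {1..cols}"
      unfolding pairs_iff by (rule mixed)
    show "(Inr i, Inl j) \<in> same_block d1 \<longleftrightarrow> (Inr i, Inl j) \<in> pairs f {1..cols}"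
      unfolding pairs_iff mixed[symmetric] using sym by blast
    show "(Inr i, Inr j) \<in> same_block d1 \<longleftrightarrow> (Inr i, Inr j) \<in> pairs f {1..cols}"
      unfolding pairs_iff
    proof
      assume ij: "(Inr i, Inr j) \<in> same_block d1"
      have "i \<in> {1..cols}"
        using dom[OF ij] by (auto simp: vertices_def)
      then obtain i' where i': "i' \<in> {1..cols}" "i = f i'"
        using bottoms by blast
      then have "(Inl i', Inr j) \<in> same_block d1"
        using f[of i'] ij trans by blast
      then have "j = f i'"
        unfolding mixed by (rule conjunct2)
      with i' \<open>i \<in> {1..cols}\<close> show "i = j \<and> i \<in> {1..cols}"
        by simp
    next
      assume "i = j \<and> i \<in> {1..cols}"
      then show "(Inr i, Inr j) \<in> same_block d1"
        using refl[of "Inr i"] by (auto simp: vertices_def)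
    qed
  qed
  with f_perm show ?thesis
    by (auto simp: is_perm_def)
qed

text \<open>The reason why the permutation character is multiplicative: the other diagrams span a
  two-sided ideal. The right factor is reduced to the left one by reflection.\<close>

lemma is_perm_compose_iff:
  assumes d: "partition_on verts d1" "partition_on verts d2"
  shows "is_perm (compose_diagrams d1 d2) \<longleftrightarrow> is_perm d1 \<and> is_perm d2"
proof -
  have "is_perm d2" if "is_perm (compose_diagrams d1 d2)"
  proof -
    have "is_perm (compose_diagrams (flip d2) (flip d1))"
      using is_perm_flip[OF that] by (simp add: flip_compose[OF d])
    then have "is_perm (flip d2)"
      using d by (intro perm_compose_left[of "flip d2" "flip d1"] partition_on_flip)
    then show ?thesis
      using is_perm_flip[of "flip d2"] by simp
  qed
  then show ?thesis
    using perm_compose[OF d] perm_compose_left[OF d] by blast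
qed

end

section \<open>The case of small $k$\<close>

context half_integer
begin

lemma isolating_empty: "isolating {} = diagrams k"
  by (simp add: isolating_def)

text \<open>The columns joined in every diagram, hence the smallest matching that occurs.\<close>

definition base :: "nat set" where
  "base = (if joined then {cols} else {})"

definition finest :: diagram where
  "finest = verts // pairs id base"

lemma base_subset: "base \<subseteq> {1..cols}"
  using cols_pos by (auto simp: base_def)

lemma id_perm: "id \<in> perms"
  by simp

lemma matching_in_diagrams:
  assumes "\<sigma> \<in> perms" "base \<subseteq> T" "T \<subseteq> {1..cols}" "joined \<Longrightarrow> \<sigma> cols = cols"
  shows "verts // pairs \<sigma> T \<in> diagrams k"
  using matching[OF assms(1,3)] assms(2,4) by (auto simp: in_diagrams_iff pairs_iff base_def)

lemma finest: "finest \<in> diagrams k" "same_block finest = pairs id base"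
  unfolding finest_def using matching_in_diagrams[OF id_perm order_refl base_subset] matching[OF id_perm base_subset]
  by simp_all

lemma finest_refines:
  assumes "d \<in> diagrams k"
  shows "pairs id base \<subseteq> same_block d"
proof -
  have "Id_on verts \<subseteq> same_block d"
    using equiv_same_block[OF partition_on_diagram[OF assms]] by (auto simp: equiv_def refl_on_def)
  moreover have "(Inl cols, Inr cols) \<in> same_block d" "(Inr cols, Inl cols) \<in> same_block d" if joined
    using assms that by (auto simp: in_diagrams_iff same_block_def)
  ultimately show ?thesis
    by (auto simp: pairs_def base_def)
qed

lemma card_coarser:
  assumes d: "d \<in> diagrams k" "d \<noteq> finest"
  shows "card d + of_bool joined + 1 \<le> 2 * cols"
proof -
  define R0 where "R0 = verts - (if joined then {Inr cols} else {})"
  define p where "p u = (if joined \<and> u = Inr cols then Inl cols else u)" for u :: "nat + nat"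
  note eq = equiv_same_block[OF partition_on_diagram[OF d(1)]]
  have p: "(u, p u) \<in> same_block d" "p u \<in> R0" if "u \<in> verts" for u
  proof -
    show "p u \<in> R0"
      using that cols_pos by (auto simp: p_def R0_def vertices_def)
    have "(u, p u) \<in> pairs id base"
      using that by (auto simp: p_def base_def pairs_def)
    then show "(u, p u) \<in> same_block d"
      using finest_refines[OF d(1)] by blast
  qed
  have sym: "(v, u) \<in> same_block d" if "(u, v) \<in> same_block d" for u v
    using that by (auto simp: same_block_def)
  have trans: "(u, w) \<in> same_block d" if "(u, v) \<in> same_block d" "(v, w) \<in> same_block d" for u v w
    using that eq by (meson equivE transD)
  have "same_block d \<noteq> pairs id base"
    using d finest inj_same_block by (metis inj_onD)
  then obtain a b where ab: "(a, b) \<in> same_block d" "(a, b) \<notin> pairs id base"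
    using finest_refines[OF d(1)] by auto
  have verts: "a \<in> verts" "b \<in> verts"
    using ab(1) eq by (auto simp: equiv_def)
  have "p a \<noteq> p b"
  proof
    assume "p a = p b"
    then have "(a, b) \<in> pairs id base"
      using verts by (auto simp: p_def base_def pairs_def split: if_splits)
    with ab(2) show False ..
  qed
  moreover have pab: "(p a, p b) \<in> same_block d"
    using p(1)[OF verts(1)] p(1)[OF verts(2)] ab(1) sym trans by meson
  ultimately have b: "p b \<in> R0 - {p a}"
    using p(2)[OF verts(2)] by auto
  have fin: "finite R0"
    using finite_vertices by (simp add: R0_def)
  have "card {B \<in> d. B \<inter> {} = {}} \<le> card (R0 - {p a})"
  proof (rule card_blocks_le[OF d(1)])
    show "finite (R0 - {p a})"
      using fin by simp
    fix B assume B: "B \<in> d"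
    note P = partition_on_diagram[OF d(1)]
    have "B \<noteq> {}" "B \<subseteq> verts"
      using P B by (auto simp: partition_on_def)
    then obtain w where w: "w \<in> B" "w \<in> verts"
      by blast
    have closed: "v \<in> B" if "u \<in> B" "(u, v) \<in> same_block d" for u v
      using same_block_image_eq[OF P B that(1)] that(2) by blast
    have pw: "p w \<in> B"
      by (rule closed[OF w(1) p(1)[OF w(2)]])
    show "B \<inter> (R0 - {p a}) \<noteq> {}"
    proof (cases "p w = p a")
      case True
      then have "p b \<in> B"
        using closed[OF _ pab] pw by simp
      with b show ?thesis
        by blast
    next
      case False
      with pw p(2)[OF w(2)] show ?thesis
        by blast
    qed
  qed
  moreover have "card (R0 - {p a}) = card R0 - 1"
    using p(2)[OF verts(1)] by simp
  moreover have "card R0 > 0"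
    using p(2)[OF verts(1)] fin by (auto simp: card_gt_0_iff)
  moreover have "card verts = 2 * cols"
    unfolding vertices_def by (subst card_Un_disjoint) (auto simp: card_image)
  then have "card R0 = 2 * cols - of_bool joined" "joined \<Longrightarrow> 2 * cols \<ge> 1"
    using cols_pos finite_vertices by (auto simp: R0_def card_Diff_subset vertices_def)
  ultimately show ?thesis
    by (cases joined) auto
qed

section \<open>The permutation character and the kernel of the representation by colorings\<close>

definition perm_sum :: "(diagram \<Rightarrow> complex) \<Rightarrow> complex" where
  "perm_sum f = (\<Sum>d\<in>diagrams k. f d * of_bool (is_perm d))"

lemma perm_sum_add: "perm_sum (f + g) = perm_sum f + perm_sum g"
  by (simp add: perm_sum_def algebra_simps sum.distrib)

lemma perm_sum_scale: "perm_sum (scale_fun c f) = c * perm_sum f"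
  by (simp add: perm_sum_def sum_distrib_left mult.assoc)

lemma id_diagram_is_perm: "is_perm (id_diagram cols)"
proof -
  have "same_block (id_diagram cols) = pairs id {1..cols}"
    by (rule pair_set_eqI) (auto simp: pairs_iff same_block_def id_diagram_def)
  then show ?thesis
    unfolding is_perm_def using id_perm by blast
qed

text \<open>The refinements of a perfect matching form a Boolean lattice, on which Moebius inversion
  gives alternating signs.\<close>

lemma perm_coefficient:
  fixes f :: "diagram \<Rightarrow> complex"
  assumes sum: "\<And>d. \<lbrakk>d \<in> diagrams k; d \<noteq> finest\<rbrakk> \<Longrightarrow>
      (\<Sum>e\<in>{e \<in> diagrams k. same_block e \<subseteq> same_block d}. f e) = 0"
    and d: "d \<in> diagrams k" "is_perm d"
  shows "f d = (-1) ^ (cols - of_bool joined) * f finest"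
proof -
  obtain \<sigma> where \<sigma>: "\<sigma> \<in> perms" "same_block d = pairs \<sigma> {1..cols}"
    using d(2) by (auto simp: is_perm_def)
  have \<sigma>_cols: "\<sigma> cols = cols" if joined
    using d(1) that \<sigma>(2) by (auto simp: in_diagrams_iff pairs_iff)
  define S where "S = {1..cols} - base"
  define e where "e T = verts // pairs \<sigma> (T \<union> base)" for T
  have e: "e T \<in> diagrams k" "same_block (e T) = pairs \<sigma> (T \<union> base)" if "T \<subseteq> S" for T
  proof -
    have T: "T \<union> base \<subseteq> {1..cols}"
      using that base_subset by (auto simp: S_def)
    show "e T \<in> diagrams k"
      unfolding e_def using \<sigma>_cols by (intro matching_in_diagrams[OF \<sigma>(1) _ T]) auto
    show "same_block (e T) = pairs \<sigma> (T \<union> base)"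
      unfolding e_def using matching[OF \<sigma>(1) T] by simp
  qed
  have eqI: "d1 = d2" if "d1 \<in> diagrams k" "d2 \<in> diagrams k" "same_block d1 = same_block d2" for d1 d2
    using inj_onD[OF inj_same_block that(3,1,2)] .
  have e_inj: "T = U" if "T \<subseteq> S" "U \<subseteq> S" "e T = e U" for T U
  proof -
    have "pairs \<sigma> (T \<union> base) = pairs \<sigma> (U \<union> base)"
      using e(2)[OF that(1)] e(2)[OF that(2)] that(3) by simp
    then have "i \<in> T \<union> base \<longleftrightarrow> i \<in> U \<union> base" for i
      using pairs_iff(3)[of i "\<sigma> i" \<sigma>] by blast
    then show ?thesis
      using that(1,2) by (auto simp: S_def)
  qed
  \<comment> \<open>\<open>\<sigma>\<close> fixes a glued last column, so cutting all other columns
    leads to the same finest diagram for every permutation. Hence the common value of the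
    coefficients.\<close>
  have "pairs \<sigma> base = pairs id base"
    using \<sigma>_cols by (auto simp: pairs_def base_def)
  then have e_empty: "e {} = finest"
    by (simp add: e_def finest_def)
  have "S \<union> base = {1..cols}"
    using base_subset by (auto simp: S_def)
  then have e_S: "e S = d"
    using e[of S] \<sigma>(2) d(1) by (intro eqI) simp_all
  have "f (e S) = (-1) ^ card S * f (e {})"
  proof (rule mobius_Pow[of S "\<lambda>T. f (e T)"])
    show "finite S"
      by (simp add: S_def)
    fix T assume T: "T \<subseteq> S" "T \<noteq> {}"
    have "{d' \<in> diagrams k. same_block d' \<subseteq> same_block (e T)} = e ` Pow T"
    proof (intro subset_antisym subsetI)
      fix d' assume "d' \<in> {d' \<in> diagrams k. same_block d' \<subseteq> same_block (e T)}"
      then have d': "d' \<in> diagrams k" "same_block d' \<subseteq> pairs \<sigma> (T \<union> base)"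
        using e(2)[OF T(1)] by auto
      \<comment> \<open>A refinement of \<open>e T\<close> is determined by the strands of
        \<open>T\<close> that it keeps.\<close>
      define U where "U = {i \<in> T. (Inl i, Inr (\<sigma> i)) \<in> same_block d'}"
      have U: "U \<subseteq> T" "U \<subseteq> S"
        using T by (auto simp: U_def)
      have sym: "(u, v) \<in> same_block d' \<longleftrightarrow> (v, u) \<in> same_block d'" for u v
        by (auto simp: same_block_def)
      have fine: "pairs \<sigma> base \<subseteq> same_block d'"
        using finest_refines[OF d'(1)] \<open>pairs \<sigma> base = pairs id base\<close> by simp
      have up: "(Inl i, Inr (\<sigma> i)) \<in> same_block d' \<longleftrightarrow> i \<in> U" if "i \<in> T" for i
        using that by (simp add: U_def)
      have "same_block d' = pairs \<sigma> (U \<union> base)"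
      proof
        show "same_block d' \<subseteq> pairs \<sigma> (U \<union> base)"
        proof (rule subrelI)
          fix u v assume uv: "(u, v) \<in> same_block d'"
          then have "(u, v) \<in> pairs \<sigma> (T \<union> base)"
            using d'(2) by blast
          then show "(u, v) \<in> pairs \<sigma> (U \<union> base)"
            using uv up sym[of u v] unfolding pairs_def by blast
        qed
        show "pairs \<sigma> (U \<union> base) \<subseteq> same_block d'"
        proof (rule subrelI)
          fix u v assume "(u, v) \<in> pairs \<sigma> (U \<union> base)"
          then consider "(u, v) \<in> pairs \<sigma> base" | i where "i \<in> U" "u = Inl i" "v = Inr (\<sigma> i)"
            | i where "i \<in> U" "v = Inl i" "u = Inr (\<sigma> i)"
            unfolding pairs_def by blast
          then show "(u, v) \<in> same_block d'"
          proof cases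
            case 1
            then show ?thesis
              using fine by blast
          next
            case 2
            then show ?thesis
              using up U(1) by blast
          next
            case 3
            then show ?thesis
              using up U(1) sym[of u v] by blast
          qed
        qed
      qed
      then have "d' = e U"
        using e[OF U(2)] d'(1) by (intro eqI) simp_all
      then show "d' \<in> e ` Pow T"
        using U(1) by blast
    next
      fix d' assume "d' \<in> e ` Pow T"
      then obtain U where U: "U \<subseteq> T" "d' = e U"
        by auto
      then have "U \<subseteq> S"
        using T(1) by auto
      moreover have "pairs \<sigma> (U \<union> base) \<subseteq> pairs \<sigma> (T \<union> base)"
        using U(1) by (auto simp: pairs_def)
      ultimately show "d' \<in> {d' \<in> diagrams k. same_block d' \<subseteq> same_block (e T)}"
        using e[of U] e(2)[OF T(1)] U(2) by simp
    qed
    moreover have "e T \<noteq> finest"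
    proof
      assume "e T = finest"
      then have "T = {}"
        using T(1) e_empty by (intro e_inj) simp_all
      with T(2) show False ..
    qed
    moreover have "inj_on e (Pow T)"
      using T(1) by (intro inj_onI e_inj) blast+
    ultimately show "(\<Sum>U\<in>Pow T. f (e U)) = 0"
      using sum[OF e(1)[OF T(1)]] by (simp add: sum.reindex)
  qed
  moreover have "card S = cols - of_bool joined"
    using base_subset by (auto simp: S_def base_def card_Diff_subset)
  ultimately show ?thesis
    by (simp add: e_S e_empty)
qed

end

context partition_alg
begin

text \<open>Products of permutation diagrams remove nothing, so no power of the parameter appears,
  and all other products contribute 0 on both sides.\<close>

lemma perm_sum_mult: "perm_sum (f \<otimes>\<^bsub>PA\<^esub> g) = perm_sum f * perm_sum g"
proof -
  have "perm_sum (f \<otimes>\<^bsub>PA\<^esub> g) = (\<Sum>d1\<in>diagrams k. \<Sum>d2\<in>diagrams k.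
     f d1 * g d2 * x ^ removed d1 d2 * of_bool (is_perm (compose_diagrams d1 d2)))"
    unfolding perm_sum_def by (rule sum_mult)
  also have "\<dots> = (\<Sum>d1\<in>diagrams k. \<Sum>d2\<in>diagrams k. (f d1 * of_bool (is_perm d1)) * (g d2 * of_bool (is_perm d2)))"
  proof (intro sum.cong refl)
    fix d1 d2 assume "d1 \<in> diagrams k" "d2 \<in> diagrams k"
    note P = this[THEN partition_on_diagram]
    show "f d1 * g d2 * x ^ removed d1 d2 * of_bool (is_perm (compose_diagrams d1 d2)) =
        (f d1 * of_bool (is_perm d1)) * (g d2 * of_bool (is_perm d2))"
      using is_perm_compose_iff[OF P] perm_compose(2)[OF P] by (cases "is_perm d1 \<and> is_perm d2") auto
  qed
  finally show ?thesis
    unfolding perm_sum_def sum_product .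
qed

end

context half_integer
begin

definition adjoint :: "(diagram \<Rightarrow> complex) \<Rightarrow> diagram \<Rightarrow> complex" where
  "adjoint f d = cnj (f (flip d))"

lemma sum_flip: "(\<Sum>d\<in>diagrams k. g (flip d)) = (\<Sum>d\<in>diagrams k. g d)"
  by (rule sum.reindex_bij_witness[of _ flip flip]) (auto intro: flip_in_diagrams)

lemma perm_sum_adjoint: "perm_sum (adjoint f) = cnj (perm_sum f)"
proof -
  have "is_perm (flip d) \<longleftrightarrow> is_perm d" for d
    using is_perm_flip[of d] is_perm_flip[of "flip d"] by auto
  then have "perm_sum (adjoint f) = (\<Sum>d\<in>diagrams k. cnj (f (flip d) * of_bool (is_perm (flip d))))"
    unfolding perm_sum_def adjoint_def by (intro sum.cong refl) simp
  also have "\<dots> = (\<Sum>d\<in>diagrams k. cnj (f d * of_bool (is_perm d)))"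
    by (rule sum_flip)
  finally show ?thesis
    by (simp add: perm_sum_def)
qed

end

context integer_partition_alg
begin

lemma mat_adjoint: "mat (adjoint f) t b = cnj (mat f b t)"
proof -
  have "mat (adjoint f) t b = (\<Sum>d\<in>diagrams k. cnj (f (flip d) * of_nat (weight (flip d) b t)))"
    unfolding mat_def adjoint_def by (intro sum.cong refl) simp
  also have "\<dots> = (\<Sum>d\<in>diagrams k. cnj (f d * of_nat (weight d b t)))"
    by (rule sum_flip)
  finally show ?thesis
    by (simp add: mat_def)
qed

text \<open>Coloring kills every sum over refinements except the one at \<open>finest\<close>. Then
  \<open>perm_sum f\<close> is a sign times the number of permutation diagrams times
  \<open>f finest\<close>, so the last sum vanishes too and uniqueness of Moebius inversion
  applies.\<close>

lemma mat_perm_sum_faithful: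
  assumes n: "n > 0" and small: "2 * cols \<le> n + 1 + of_bool joined"
    and f: "f \<in> carrier PA" and mat: "\<And>t b. \<lbrakk>t \<in> cs; b \<in> cs\<rbrakk> \<Longrightarrow> mat f t b = 0"
    and perm: "perm_sum f = 0"
  shows "f = 0"
proof -
  have sum: "(\<Sum>e\<in>{e \<in> diagrams k. same_block e \<subseteq> same_block d}. f e) = 0"
    if d: "d \<in> diagrams k" "d \<noteq> finest" for d
  proof -
    have "card d \<le> n"
      using card_coarser[OF d] small by simp
    then show ?thesis
      using sum_refinements_eq_0[of "{}" f d] mat d(1) n f by (simp add: isolating_empty carrier_PA)
  qed
  have "0 = (\<Sum>d\<in>diagrams k. f d * of_bool (is_perm d))"
    using perm by (simp add: perm_sum_def)
  also have "\<dots> = (\<Sum>d\<in>{d \<in> diagrams k. is_perm d}. f d)"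
    using finite_diagrams unfolding sum.inter_filter[OF finite_diagrams] by (intro sum.cong refl) simp
  also have "\<dots> = (\<Sum>d\<in>{d \<in> diagrams k. is_perm d}. (-1) ^ (cols - of_bool joined) * f finest)"
    using perm_coefficient[OF sum] by (intro sum.cong refl) blast
  also have "\<dots> = of_nat (card {d \<in> diagrams k. is_perm d}) * ((-1) ^ (cols - of_bool joined) * f finest)"
    by simp
  finally have "card {d \<in> diagrams k. is_perm d} = 0 \<or> f finest = 0"
    by auto
  \<comment> \<open>The identity diagram keeps the number of permutation diagrams from being
    0.\<close>
  moreover have "id_diagram cols \<in> {d \<in> diagrams k. is_perm d}"
    using id_in_diagrams id_diagram_is_perm by simp
  then have "card {d \<in> diagrams k. is_perm d} \<noteq> 0"
    using finite_diagrams by (subst card_0_eq) auto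
  ultimately have finest_0: "f finest = 0"
    by blast
  have sum_all: "(\<Sum>e\<in>{e \<in> diagrams k. same_block e \<subseteq> same_block d}. f e) = 0" if d: "d \<in> diagrams k" for d
  proof (cases "d = finest")
    case True
    have "e = finest" if "e \<in> diagrams k" "same_block e \<subseteq> same_block finest" for e
      using that finest finest_refines[OF that(1)] by (intro inj_onD[OF inj_same_block]) auto
    then have "{e \<in> diagrams k. same_block e \<subseteq> same_block finest} = {finest}"
      using finest(1) by blast
    then show ?thesis
      using True finest_0 by simp
  qed (use sum d in blast)
  have "f d = 0" if "d \<in> diagrams k" for d
    using zeta_injective[OF finite_diagrams inj_same_block finite_same_block sum_all that] .
  then show ?thesis
    using f by (auto simp: fun_eq_iff carrier_PA)
qed

text \<open>The Hilbert-Schmidt inner product of the matrices plus the Hermitian product of the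
  character values.\<close>

definition form :: "(diagram \<Rightarrow> complex) \<Rightarrow> (diagram \<Rightarrow> complex) \<Rightarrow> complex" where
  "form f g = (\<Sum>t\<in>cs. \<Sum>b\<in>cs. mat f t b * cnj (mat g t b)) + perm_sum f * cnj (perm_sum g)"

lemma form_self:
  "form f f = of_real ((\<Sum>t\<in>cs. \<Sum>b\<in>cs. (cmod (mat f t b))\<^sup>2) + (cmod (perm_sum f))\<^sup>2)"
  unfolding form_def by (simp only: of_real_add of_real_sum complex_norm_square)

text \<open>For the Hilbert-Schmidt product, the adjoint of multiplying by a matrix is multiplying
  by its conjugate transpose; the character turns \<open>adjoint\<close> into conjugation.\<close>

lemma form_mult: "form (a \<otimes>\<^bsub>PA\<^esub> f) g = form f (adjoint a \<otimes>\<^bsub>PA\<^esub> g)"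
proof -
  have "(\<Sum>t\<in>cs. \<Sum>b\<in>cs. mat (a \<otimes>\<^bsub>PA\<^esub> f) t b * cnj (mat g t b)) =
      (\<Sum>t\<in>cs. \<Sum>b\<in>cs. \<Sum>c\<in>cs. mat f c b * cnj (mat (adjoint a) c t * mat g t b))"
    by (intro sum.cong refl) (simp add: mat_mult mat_adjoint sum_distrib_left sum_distrib_right mult_ac)
  also have "\<dots> = (\<Sum>t\<in>cs. \<Sum>c\<in>cs. \<Sum>b\<in>cs. mat f c b * cnj (mat (adjoint a) c t * mat g t b))"
    by (intro sum.cong refl sum.swap)
  also have "\<dots> = (\<Sum>c\<in>cs. \<Sum>t\<in>cs. \<Sum>b\<in>cs. mat f c b * cnj (mat (adjoint a) c t * mat g t b))"
    by (rule sum.swap)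
  also have "\<dots> = (\<Sum>c\<in>cs. \<Sum>b\<in>cs. \<Sum>t\<in>cs. mat f c b * cnj (mat (adjoint a) c t * mat g t b))"
    by (intro sum.cong refl sum.swap)
  also have "\<dots> = (\<Sum>c\<in>cs. \<Sum>b\<in>cs. mat f c b * cnj (mat (adjoint a \<otimes>\<^bsub>PA\<^esub> g) c b))"
    by (intro sum.cong refl) (simp add: mat_mult sum_distrib_left)
  finally show ?thesis
    by (simp add: form_def perm_sum_mult perm_sum_adjoint mult_ac)
qed

lemma semisimple_PA:
  assumes n: "n > 0" and small: "2 * cols \<le> n + 1 + of_bool joined"
  shows "semisimple_algebra PA"
proof -
  interpret star_form PA "diagrams k" form
  proof
    fix f g h a :: "diagram \<Rightarrow> complex" and c :: complex
    show "form (f + g) h = form f h + form g h"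
      by (simp add: form_def mat_add perm_sum_add algebra_simps sum.distrib)
    show "form (scale_fun c f) h = c * form f h"
      by (simp add: form_def mat_scale perm_sum_scale algebra_simps sum_distrib_left)
    show "form f g = cnj (form g f)"
      by (simp add: form_def mult.commute)
    show "f = 0" if "f \<in> carrier PA" "form f f = 0"
    proof -
      have "(\<Sum>t\<in>cs. \<Sum>b\<in>cs. (cmod (mat f t b))\<^sup>2) + (cmod (perm_sum f))\<^sup>2 = 0"
        using that(2) unfolding form_self of_real_eq_0_iff .
      moreover have nonneg: "(\<Sum>t\<in>cs. \<Sum>b\<in>cs. (cmod (mat f t b))\<^sup>2) \<ge> 0"
        by (intro sum_nonneg zero_le_power2)
      ultimately have "(\<Sum>t\<in>cs. \<Sum>b\<in>cs. (cmod (mat f t b))\<^sup>2) = 0" and perm: "perm_sum f = 0"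
        by (simp_all add: add_nonneg_eq_0_iff)
      then have "\<forall>t\<in>cs. (\<Sum>b\<in>cs. (cmod (mat f t b))\<^sup>2) = 0"
        by (subst (asm) sum_nonneg_eq_0_iff[OF finite_colorings]) (auto intro: sum_nonneg)
      then have "\<forall>t\<in>cs. \<forall>b\<in>cs. (cmod (mat f t b))\<^sup>2 = 0"
        using sum_nonneg_eq_0_iff[OF finite_colorings, of cols n "\<lambda>b. (cmod (mat f _ b))\<^sup>2"] by simp
      then show ?thesis
        using mat_perm_sum_faithful[OF n small that(1) _ perm] by simp
    qed
    show "\<exists>a'\<in>carrier PA. \<forall>f\<in>carrier PA. \<forall>g\<in>carrier PA. form (a \<otimes>\<^bsub>PA\<^esub> f) g = form f (a' \<otimes>\<^bsub>PA\<^esub> g)"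
      if "a \<in> carrier PA"
    proof -
      have "adjoint a \<in> carrier PA"
        using that flip_in_diagrams[of "flip _"] by (auto simp: carrier_PA adjoint_def)
      then show ?thesis
        using form_mult by blast
    qed
  qed
  show ?thesis
    by (rule semisimple)
qed

end

theorem theorem3p27:
  fixes n :: nat and k :: rat
  assumes "n \<ge> 2" and "2 * k \<in> \<nat>"
  shows "semisimple_algebra (partition_algebra k (of_nat n)) \<longleftrightarrow> k \<le> (of_nat n + 1) / 2"
proof -
  interpret integer_partition_alg k n
    by standard (rule assms(2))
  \<comment> \<open>Doubling turns the bound into an inequality of natural numbers, whose negation
    is the hypothesis \<open>large\<close> of \<open>not_semisimple\<close>.\<close>
  have "k \<le> (of_nat n + 1) / 2 \<longleftrightarrow> 2 * k \<le> of_nat (n + 1)"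
    by auto
  also have "\<dots> \<longleftrightarrow> of_nat (2 * cols) \<le> (of_nat (n + 1 + of_bool joined) :: rat)"
    unfolding two_k by (simp add: algebra_simps)
  also have "\<dots> \<longleftrightarrow> 2 * cols \<le> n + 1 + of_bool joined"
    by (rule of_nat_le_iff)
  finally show ?thesis
    using semisimple_PA not_semisimple assms(1) by fastforce
qed

end
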